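(* For a graph $G$ having $m$ edges, $\operatorname{lbox}(G)\le \left(2^{13\log^{*}\sqrt{m}}+2\right)\sqrt{m}$. Further, there exists a graph with $m$ edges whose local boxicity is $\Omega\!\left(\frac{\sqrt m}{\log m}\right)$.
   Context: All graphs are finite, simple and undirected. An interval graph is a graph whose vertices can be mapped to closed intervals of the real line so that two distinct vertices are adjacent if and only if their intervals intersect. For graphs $G, I_1,\dots,I_k$ on the same vertex set, $G=\bigcap_{i=1}^k I_i$ means $E(G)=E(I_1)\cap\cdots\cap E(I_k)$. A vertex is universal in a graph if it is adjacent to all other vertices of that graph, and non-universal otherwise. The local boxicity $\operatorname{lbox}(G)$ is the smallest positive integer $l$ such that, for some $k$, $G=\bigcap_{i=1}^k I_i$ where each $I_i$ is an interval graph on $V(G)$ and each vertex of $G$ is a non-universal vertex in at most $l$ of the graphs $I_1,\dots,I_k$. Logarithms are to base $2$, and $\log^{*}x$ denotes the iterated logarithm: the number of times the $\log$ function is applied, starting from $x$, to get a result less than or equal to $1$.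
   Formalization: The upper bound is stated for graphs with at least one edge (m ≥ 1); for m = 0 it is false, since local boxicity is a positive integer (equal to 1 for an edgeless graph) while the right-hand side is 0. *)

theory Defs
  imports Complex_Main "HOL-Library.Landau_Symbols"
begin

definition simple_graph :: "'a set \<Rightarrow> 'a set set \<Rightarrow> bool" where
  "simple_graph V E \<longleftrightarrow> finite V \<and> (\<forall>e\<in>E. e \<subseteq> V \<and> card e = 2)"

definition interval_graph :: "'a set \<Rightarrow> 'a set set \<Rightarrow> bool" where
  "interval_graph V E \<longleftrightarrow> simple_graph V E \<and>
     (\<exists>a b :: 'a \<Rightarrow> real. (\<forall>v\<in>V. a v \<le> b v) \<and>
       (\<forall>u\<in>V. \<forall>v\<in>V. u \<noteq> v \<longrightarrow>
         ({u, v} \<in> E \<longleftrightarrow> {a u..b u} \<inter> {a v..b v} \<noteq> {})))"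

definition universal_vertex :: "'a set \<Rightarrow> 'a set set \<Rightarrow> 'a \<Rightarrow> bool" where
  "universal_vertex V E v \<longleftrightarrow> v \<in> V \<and> (\<forall>u\<in>V. u \<noteq> v \<longrightarrow> {v, u} \<in> E)"

(* An empty family is excluded (1 \<le> k): its intersection would be UNIV. This does not affect the
   local boxicity, since a complete graph is itself an interval graph in which every vertex is
   universal. *)
definition has_local_box_rep :: "'a set \<Rightarrow> 'a set set \<Rightarrow> nat \<Rightarrow> bool" where
  "has_local_box_rep V E l \<longleftrightarrow>
     (\<exists>k\<ge>1. \<exists>I :: nat \<Rightarrow> 'a set set.
        (\<forall>i\<in>{1..k}. interval_graph V (I i)) \<and>
        E = (\<Inter>i\<in>{1..k}. I i) \<and>
        (\<forall>v\<in>V. card {i\<in>{1..k}. \<not> universal_vertex V (I i) v} \<le> l))"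

definition lbox :: "'a set \<Rightarrow> 'a set set \<Rightarrow> nat" where
  "lbox V E = (LEAST l. 1 \<le> l \<and> has_local_box_rep V E l)"

(* Iterates that are computed after the first one with value at most 1 (where log leaves its
   natural domain) play no role, because LEAST selects the first such iterate. *)
definition log_star :: "real \<Rightarrow> nat" where
  "log_star x = (LEAST k. (log 2 ^^ k) x \<le> 1)"

end

theory Submission
  imports Defs "HOL-Analysis.Harmonic_Numbers"
begin

text \<open>Upper bound. Suppose that the vertices of a graph of maximum degree \<open>n\<close> are coloured with \<open>k\<close>
  colours so that every vertex has at most \<open>d\<close> neighbours of each colour. The graph is the
  intersection of its restrictions to pairs of colour classes, these have maximum degree at most
  \<open>2 d\<close>, and each vertex is non-universal in only \<open>k\<close> of them. Such colourings exist with \<open>d\<close> about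
  \<open>log n\<close> and \<open>k\<close> about \<open>12 n / d\<close>, so the ratio of local boxicity and degree grows by a constant
  factor when the degree drops to \<open>O(log n)\<close>; small degrees are settled by colouring the square of
  the graph, where pairs of classes induce matchings. In a graph with \<open>m\<close> edges, at most
  \<open>2 * sqrt m\<close> vertices have degree above \<open>sqrt m\<close>, and each of them costs one interval graph.

  Lower bound. At most \<open>(n + 1) ^ (5 * n * l)\<close> of the \<open>2 ^ (n choose 2)\<close> graphs on \<open>n\<close> vertices have
  local boxicity at most \<open>l\<close>, so some graph on about \<open>sqrt m\<close> vertices needs
  \<open>l\<close> of order \<open>sqrt m / log m\<close>; a disjoint star brings its number of edges to \<open>m\<close>.\<close>

section \<open>Families of interval representations\<close>

definition nbhd :: "'a set \<Rightarrow> 'a set set \<Rightarrow> 'a \<Rightarrow> 'a set" where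
  "nbhd V E v = {u \<in> V. u \<noteq> v \<and> {u, v} \<in> E}"

definition overlap :: "('a \<Rightarrow> real) \<Rightarrow> ('a \<Rightarrow> real) \<Rightarrow> 'a \<Rightarrow> 'a \<Rightarrow> bool" where
  "overlap a b u v \<longleftrightarrow> a u \<le> b v \<and> a v \<le> b u"

text \<open>An encoding by endpoints over any finite index type, with empty families allowed. Taking
  \<open>u = v\<close> in the last conjunct is harmless: since \<open>a j v \<le> b j v\<close>, a
  vertex overlaps itself, so the counted indices are those in which \<open>v\<close> is
  non-universal.\<close>

definition box_family ::
  "'a set \<Rightarrow> 'a set set \<Rightarrow> 'j set \<Rightarrow> ('j \<Rightarrow> 'a \<Rightarrow> real) \<Rightarrow> ('j \<Rightarrow> 'a \<Rightarrow> real) \<Rightarrow> nat \<Rightarrow> bool" where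
  "box_family V E J a b l \<longleftrightarrow> finite J \<and> (\<forall>j\<in>J. \<forall>v\<in>V. a j v \<le> b j v) \<and>
     (\<forall>u\<in>V. \<forall>v\<in>V. u \<noteq> v \<longrightarrow> ({u, v} \<in> E \<longleftrightarrow> (\<forall>j\<in>J. overlap (a j) (b j) u v))) \<and>
     (\<forall>v\<in>V. card {j\<in>J. \<exists>u\<in>V. \<not> overlap (a j) (b j) u v} \<le> l)"

text \<open>A definition cannot quantify over index types, hence the fixed type
  \<open>nat set\<close>; \<open>local_boxI\<close> accepts any other index type.\<close>

definition local_box :: "'a set \<Rightarrow> 'a set set \<Rightarrow> nat \<Rightarrow> bool" where
  "local_box V E l \<longleftrightarrow> (\<exists>(J :: nat set) a b. box_family V E J a b l)"

lemma box_familyD: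
  assumes "box_family V E J a b l"
  shows "finite J"
    and "j \<in> J \<Longrightarrow> v \<in> V \<Longrightarrow> a j v \<le> b j v"
    and "u \<in> V \<Longrightarrow> v \<in> V \<Longrightarrow> u \<noteq> v \<Longrightarrow> {u, v} \<in> E \<longleftrightarrow> (\<forall>j\<in>J. overlap (a j) (b j) u v)"
    and "v \<in> V \<Longrightarrow> card {j\<in>J. \<exists>u\<in>V. \<not> overlap (a j) (b j) u v} \<le> l"
  using assms by (simp_all add: box_family_def)

lemma overlap_commute: "overlap a b u v \<longleftrightarrow> overlap a b v u"
  by (auto simp: overlap_def)

lemma overlap_iff_Int:
  assumes "a u \<le> b u" "a v \<le> b v"
  shows "overlap a b u v \<longleftrightarrow> {a u..b u} \<inter> {a v..b v} \<noteq> {}"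
  using assms by (auto simp: overlap_def)

lemma box_family_reindex:
  assumes "box_family V E J a b l" and h: "bij_betw h K J"
  shows "box_family V E K (a \<circ> h) (b \<circ> h) l"
proof -
  have J: "J = h ` K" and inj: "inj_on h K"
    using h by (auto simp: bij_betw_def)
  have "card {j\<in>K. \<exists>u\<in>V. \<not> overlap (a (h j)) (b (h j)) u v}
      = card {j\<in>J. \<exists>u\<in>V. \<not> overlap (a j) (b j) u v}" for v
  proof -
    have "{j\<in>J. \<exists>u\<in>V. \<not> overlap (a j) (b j) u v}
        = h ` {j\<in>K. \<exists>u\<in>V. \<not> overlap (a (h j)) (b (h j)) u v}"
      unfolding J by blast
    then show ?thesis
      by (simp add: card_image inj_on_subset[OF inj])
  qed
  moreover have "finite K"
    using assms bij_betw_finite by (auto simp: box_family_def)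
  ultimately show ?thesis
    using assms(1) unfolding box_family_def J by simp
qed

lemma local_boxI:
  assumes "box_family V E J a b l"
  shows "local_box V E l"
proof -
  have "finite J"
    using assms by (simp add: box_family_def)
  then obtain h where "bij_betw h {0..<card J} J"
    using ex_bij_betw_nat_finite by blast
  then show ?thesis
    using box_family_reindex[OF assms] unfolding local_box_def by blast
qed

lemma local_box_mono:
  assumes "local_box V E l" "l \<le> l'"
  shows "local_box V E l'"
proof -
  obtain J :: "nat set" and a b where "box_family V E J a b l"
    using assms(1) unfolding local_box_def by blast
  then have "box_family V E J a b l'"
    using \<open>l \<le> l'\<close> by (auto simp: box_family_def intro: order_trans)
  then show ?thesis
    by (rule local_boxI)
qed

text \<open>Restricting every interval graph to \<open>S\<close> keeps the overlaps and creates no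
  new non-universal vertices.\<close>

lemma local_box_induced:
  assumes box: "local_box V E l" and "S \<subseteq> V"
    and agree: "\<And>u v. u \<in> S \<Longrightarrow> v \<in> S \<Longrightarrow> u \<noteq> v \<Longrightarrow> {u, v} \<in> E' \<longleftrightarrow> {u, v} \<in> E"
  shows "local_box S E' l"
proof -
  obtain J :: "nat set" and a b where fam: "box_family V E J a b l"
    using box unfolding local_box_def by blast
  have "card {j\<in>J. \<exists>u\<in>S. \<not> overlap (a j) (b j) u v} \<le> l" if "v \<in> S" for v
  proof -
    have "card {j\<in>J. \<exists>u\<in>S. \<not> overlap (a j) (b j) u v}
        \<le> card {j\<in>J. \<exists>u\<in>V. \<not> overlap (a j) (b j) u v}"
      using fam \<open>S \<subseteq> V\<close> by (intro card_mono) (auto simp: box_family_def)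
    also have "\<dots> \<le> l"
      using fam \<open>S \<subseteq> V\<close> that by (auto simp: box_family_def)
    finally show ?thesis .
  qed
  moreover have "{u, v} \<in> E' \<longleftrightarrow> (\<forall>j\<in>J. overlap (a j) (b j) u v)"
    if "u \<in> S" "v \<in> S" "u \<noteq> v" for u v
    using box_familyD(3)[OF fam, of u v] \<open>S \<subseteq> V\<close> that agree[OF that] by blast
  moreover have "\<forall>j\<in>J. \<forall>v\<in>S. a j v \<le> b j v" "finite J"
    using fam \<open>S \<subseteq> V\<close> by (auto simp: box_family_def)
  ultimately have "box_family S E' J a b l"
    by (simp add: box_family_def)
  then show ?thesis
    by (rule local_boxI)
qed

lemma local_box_interval:
  assumes "\<And>v. v \<in> V \<Longrightarrow> a v \<le> b v"
    and "\<And>u v. u \<in> V \<Longrightarrow> v \<in> V \<Longrightarrow> u \<noteq> v \<Longrightarrow> {u, v} \<in> E \<longleftrightarrow> overlap a b u v"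
  shows "local_box V E 1"
proof -
  have "card {j \<in> {()}. Q j} \<le> 1" for Q
    using card_mono[of "{()}" "{j \<in> {()}. Q j}"] by fastforce
  then have "box_family V E {()} (\<lambda>_. a) (\<lambda>_. b) 1"
    using assms by (auto simp: box_family_def)
  then show ?thesis
    by (rule local_boxI)
qed

section \<open>Translation between endpoint families and the definition of local boxicity\<close>

lemma local_box_if_rep:
  assumes "has_local_box_rep V E l"
  shows "local_box V E l"
proof -
  obtain k I where I: "\<forall>i\<in>{1..k::nat}. interval_graph V (I i)"
    and E: "E = (\<Inter>i\<in>{1..k}. I i)"
    and l: "\<forall>v\<in>V. card {i\<in>{1..k}. \<not> universal_vertex V (I i) v} \<le> l"
    using assms unfolding has_local_box_rep_def by blast
  have "\<forall>i\<in>{1..k}. \<exists>a b. (\<forall>v\<in>V. a v \<le> b v) \<and>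
      (\<forall>u\<in>V. \<forall>v\<in>V. u \<noteq> v \<longrightarrow> ({u, v} \<in> I i \<longleftrightarrow> overlap a b u v))"
    using I unfolding interval_graph_def by (metis overlap_iff_Int)
  then obtain a b where
    ab: "\<And>i v. i \<in> {1..k} \<Longrightarrow> v \<in> V \<Longrightarrow> a i v \<le> b i v" and
    ov: "\<And>i u v. i \<in> {1..k} \<Longrightarrow> u \<in> V \<Longrightarrow> v \<in> V \<Longrightarrow> u \<noteq> v \<Longrightarrow>
           {u, v} \<in> I i \<longleftrightarrow> overlap (a i) (b i) u v"
    by metis
  have "card {i\<in>{1..k}. \<exists>u\<in>V. \<not> overlap (a i) (b i) u v} \<le> l" if v: "v \<in> V" for v
  proof -
    have "{i\<in>{1..k}. \<exists>u\<in>V. \<not> overlap (a i) (b i) u v}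
        \<subseteq> {i\<in>{1..k}. \<not> universal_vertex V (I i) v}"
    proof clarify
      fix i u assume *: "i \<in> {1..k}" "u \<in> V" "\<not> overlap (a i) (b i) u v" "universal_vertex V (I i) v"
      have "u \<noteq> v"
        using * ab v unfolding overlap_def by blast
      then show False
        using * ov[OF *(1) v *(2)] v by (auto simp: universal_vertex_def overlap_commute)
    qed
    then have "card {i\<in>{1..k}. \<exists>u\<in>V. \<not> overlap (a i) (b i) u v}
        \<le> card {i\<in>{1..k}. \<not> universal_vertex V (I i) v}"
      by (intro card_mono) auto
    then show ?thesis
      using l v by (meson order_trans)
  qed
  then have "box_family V E {1..k} a b l"
    using ab ov unfolding box_family_def E by auto
  then show ?thesis
    by (rule local_boxI)
qed

lemma rep_if_local_box:
  assumes graph: "simple_graph V E" and "local_box V E l"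
  shows "has_local_box_rep V E l"
proof -
  obtain J :: "nat set" and a b where fam: "box_family V E J a b l"
    using assms unfolding local_box_def by blast
  define k where "k = card J + 1"
  have "finite J"
    using fam by (simp add: box_family_def)
  then obtain h where h: "bij_betw h {1..card J} J"
    using ex_bij_betw_nat_finite_1 by blast
  have fam': "box_family V E {1..card J} (a \<circ> h) (b \<circ> h) l"
    using box_family_reindex[OF fam h] .
  \<comment> \<open>The index \<open>k\<close> carries the complete graph, so that the family is nonempty.\<close>
  define a' where "a' i = (if i \<le> card J then a (h i) else (\<lambda>_. 0))" for i
  define b' where "b' i = (if i \<le> card J then b (h i) else (\<lambda>_. 0))" for i
  define I where "I i = {{u, v} | u v. u \<in> V \<and> v \<in> V \<and> u \<noteq> v \<and> overlap (a' i) (b' i) u v}" for i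
  have ab': "a' i v \<le> b' i v" if "i \<in> {1..k}" "v \<in> V" for i v
    using fam' that by (auto simp: box_family_def a'_def b'_def)
  have I: "{u, v} \<in> I i \<longleftrightarrow> overlap (a' i) (b' i) u v" if "u \<in> V" "v \<in> V" "u \<noteq> v" for u v i
  proof
    assume "{u, v} \<in> I i"
    then obtain x y where "{u, v} = {x, y}" "overlap (a' i) (b' i) x y"
      unfolding I_def by blast
    then show "overlap (a' i) (b' i) u v"
      by (metis doubleton_eq_iff overlap_commute)
  next
    assume "overlap (a' i) (b' i) u v"
    then show "{u, v} \<in> I i"
      using that unfolding I_def by blast
  qed
  have IE: "{u, v} \<in> E \<longleftrightarrow> (\<forall>i\<in>{1..k}. {u, v} \<in> I i)" if "u \<in> V" "v \<in> V" "u \<noteq> v" for u v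
  proof -
    have "(\<forall>i\<in>{1..k}. {u, v} \<in> I i) \<longleftrightarrow> (\<forall>i\<in>{1..k}. overlap (a' i) (b' i) u v)"
      using I[OF that] by blast
    also have "\<dots> \<longleftrightarrow> (\<forall>i\<in>{1..card J}. overlap (a (h i)) (b (h i)) u v)"
      by (auto simp: k_def a'_def b'_def overlap_def)
    finally show ?thesis
      using fam' that by (simp add: box_family_def)
  qed
  have fin: "finite V" and sub: "\<forall>e\<in>E. e \<subseteq> V \<and> card e = 2"
    using graph by (auto simp: simple_graph_def)
  have "interval_graph V (I i)" if "i \<in> {1..k}" for i
    unfolding interval_graph_def
  proof (intro conjI exI ballI impI)
    show "simple_graph V (I i)"
      using fin by (auto simp: simple_graph_def I_def)
    show "a' i v \<le> b' i v" if "v \<in> V" for v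
      using ab' \<open>i \<in> {1..k}\<close> that .
    show "{u, v} \<in> I i \<longleftrightarrow> {a' i u..b' i u} \<inter> {a' i v..b' i v} \<noteq> {}"
      if "u \<in> V" "v \<in> V" "u \<noteq> v" for u v
      using I[OF that] overlap_iff_Int[of "a' i" u "b' i" v] ab'[OF \<open>i \<in> {1..k}\<close>] that by simp
  qed
  moreover have "E = (\<Inter>i\<in>{1..k}. I i)"
  proof (intro set_eqI iffI)
    fix e assume "e \<in> E"
    then obtain u v where "e = {u, v}" "u \<in> V" "v \<in> V" "u \<noteq> v"
      using sub by (metis card_2_iff insert_subset)
    then show "e \<in> (\<Inter>i\<in>{1..k}. I i)"
      using IE \<open>e \<in> E\<close> by blast
  next
    fix e assume e: "e \<in> (\<Inter>i\<in>{1..k}. I i)"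
    \<comment> \<open>Membership in the complete graph \<open>I k\<close> is what makes
      \<open>e\<close> a pair of distinct vertices.\<close>
    then have "e \<in> I k"
      by (simp add: k_def)
    then obtain u v where "e = {u, v}" "u \<in> V" "v \<in> V" "u \<noteq> v"
      unfolding I_def by blast
    then show "e \<in> E"
      using IE e by blast
  qed
  moreover have "card {i\<in>{1..k}. \<not> universal_vertex V (I i) v} \<le> l" if v: "v \<in> V" for v
  proof -
    have "{i\<in>{1..k}. \<not> universal_vertex V (I i) v}
        \<subseteq> {i\<in>{1..card J}. \<exists>u\<in>V. \<not> overlap ((a \<circ> h) i) ((b \<circ> h) i) u v}"
    proof clarify
      fix i assume i: "i \<in> {1..k}" and "\<not> universal_vertex V (I i) v"
      then obtain u where u: "u \<in> V" "u \<noteq> v" "{v, u} \<notin> I i"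
        using v by (auto simp: universal_vertex_def)
      then have "\<not> overlap (a' i) (b' i) u v"
        using I[of v u i] v overlap_commute by metis
      then show "i \<in> {1..card J} \<and> (\<exists>u\<in>V. \<not> overlap ((a \<circ> h) i) ((b \<circ> h) i) u v)"
        using u i by (auto simp: a'_def b'_def overlap_def split: if_splits)
    qed
    then have "card {i\<in>{1..k}. \<not> universal_vertex V (I i) v}
        \<le> card {i\<in>{1..card J}. \<exists>u\<in>V. \<not> overlap ((a \<circ> h) i) ((b \<circ> h) i) u v}"
      by (intro card_mono) auto
    also have "\<dots> \<le> l"
      using fam' v unfolding box_family_def by blast
    finally show ?thesis .
  qed
  moreover have "k \<ge> 1"
    by (simp add: k_def)
  ultimately show ?thesis
    unfolding has_local_box_rep_def by blast
qed

lemma lbox_le: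
  assumes "simple_graph V E" "local_box V E l" "1 \<le> l"
  shows "lbox V E \<le> l"
  unfolding lbox_def using assms rep_if_local_box by (intro Least_le) blast

text \<open>The minimum in the definition of \<open>lbox\<close> is attained as soon as some
  positive value is admissible, for instance \<open>max 1 l\<close>.\<close>

lemma local_box_lbox:
  assumes "simple_graph V E" "local_box V E l"
  shows "local_box V E (lbox V E)"
proof -
  have "local_box V E (max 1 l)"
    using assms(2) by (rule local_box_mono) simp
  then have "1 \<le> max 1 l \<and> has_local_box_rep V E (max 1 l)"
    using rep_if_local_box[OF assms(1)] by simp
  then have "has_local_box_rep V E (lbox V E)"
    unfolding lbox_def by (rule LeastI2) blast
  then show ?thesis
    by (rule local_box_if_rep)
qed

text \<open>Each interval graph on \<open>S p\<close> extends to \<open>V\<close> by making all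
  outside vertices universal, so a vertex pays only for the pieces that contain it. The union of the
  extended families represents \<open>E\<close>.\<close>

lemma local_box_combine:
  fixes S :: "'p \<Rightarrow> 'a set"
  assumes "finite V" and "finite P"
    and S: "\<And>p. p \<in> P \<Longrightarrow> S p \<subseteq> V"
    and box: "\<And>p. p \<in> P \<Longrightarrow> local_box (S p) (H p) (l p)"
    and E: "\<And>u v. u \<in> V \<Longrightarrow> v \<in> V \<Longrightarrow> u \<noteq> v \<Longrightarrow>
              {u, v} \<in> E \<longleftrightarrow> (\<forall>p\<in>P. u \<in> S p \<longrightarrow> v \<in> S p \<longrightarrow> {u, v} \<in> H p)"
    and L: "\<And>v. v \<in> V \<Longrightarrow> (\<Sum>p\<in>{p\<in>P. v \<in> S p}. l p) \<le> L"
  shows "local_box V E L"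
proof -
  have "\<forall>p\<in>P. \<exists>(J :: nat set) a b. box_family (S p) (H p) J a b (l p)"
    using box unfolding local_box_def by blast
  then obtain J :: "'p \<Rightarrow> nat set" and a b where
    fam: "\<And>p. p \<in> P \<Longrightarrow> box_family (S p) (H p) (J p) (a p) (b p) (l p)"
    by metis
  \<comment> \<open>Vertices outside \<open>S p\<close> get an interval that contains all intervals of \<open>S p\<close>.\<close>
  define M where "M p j = (\<Sum>u\<in>S p. \<bar>a p j u\<bar> + \<bar>b p j u\<bar>)" for p j
  have M: "a p j u \<le> M p j \<and> - M p j \<le> b p j u" if "p \<in> P" "u \<in> S p" for p j u
  proof -
    have "\<bar>a p j u\<bar> + \<bar>b p j u\<bar> \<le> M p j"
      unfolding M_def using that S[OF that(1)] \<open>finite V\<close> finite_subset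
      by (intro member_le_sum) auto
    then show ?thesis by linarith
  qed
  have M0: "0 \<le> M p j" for p j
    by (simp add: M_def sum_nonneg)
  define a' where "a' = (\<lambda>(p, j) u. if u \<in> S p then a p j u else - M p j)"
  define b' where "b' = (\<lambda>(p, j) u. if u \<in> S p then b p j u else M p j)"
  define K where "K = (SIGMA p:P. J p)"
  have finJ: "finite (J p)" if "p \<in> P" for p
    using fam[OF that] by (simp add: box_family_def)
  have ov: "overlap (a' (p, j)) (b' (p, j)) u v \<longleftrightarrow>
      (u \<in> S p \<and> v \<in> S p \<longrightarrow> overlap (a p j) (b p j) u v)" if "p \<in> P" for p j u v
    using M[OF that, of u j] M[OF that, of v j] M0[of p j]
    by (auto simp: overlap_def a'_def b'_def)
  have "finite K"
    using \<open>finite P\<close> finJ by (simp add: K_def)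
  moreover have "a' q v \<le> b' q v" if "q \<in> K" "v \<in> V" for q v
    using that fam M0 by (auto simp: K_def a'_def b'_def box_family_def order_trans[of _ 0])
  moreover have "{u, v} \<in> E \<longleftrightarrow> (\<forall>q\<in>K. overlap (a' q) (b' q) u v)"
    if "u \<in> V" "v \<in> V" "u \<noteq> v" for u v
  proof -
    have "(\<forall>q\<in>K. overlap (a' q) (b' q) u v)
        \<longleftrightarrow> (\<forall>p\<in>P. u \<in> S p \<and> v \<in> S p \<longrightarrow> (\<forall>j\<in>J p. overlap (a p j) (b p j) u v))"
      using ov by (auto simp: K_def)
    also have "\<dots> \<longleftrightarrow> (\<forall>p\<in>P. u \<in> S p \<longrightarrow> v \<in> S p \<longrightarrow> {u, v} \<in> H p)"
      using fam that unfolding box_family_def by blast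
    finally show ?thesis
      using E[OF that] by simp
  qed
  moreover have "card {q\<in>K. \<exists>u\<in>V. \<not> overlap (a' q) (b' q) u v} \<le> L" if v: "v \<in> V" for v
  proof -
    let ?D = "\<lambda>p. {j\<in>J p. \<exists>u\<in>S p. \<not> overlap (a p j) (b p j) u v}"
    have "{q\<in>K. \<exists>u\<in>V. \<not> overlap (a' q) (b' q) u v} \<subseteq> (SIGMA p:{p\<in>P. v \<in> S p}. ?D p)"
      using ov by (auto simp: K_def)
    then have "card {q\<in>K. \<exists>u\<in>V. \<not> overlap (a' q) (b' q) u v} \<le> card (SIGMA p:{p\<in>P. v \<in> S p}. ?D p)"
      using \<open>finite P\<close> finJ by (intro card_mono) auto
    also have "\<dots> = (\<Sum>p\<in>{p\<in>P. v \<in> S p}. card (?D p))"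
      using \<open>finite P\<close> finJ by (intro card_SigmaI) auto
    also have "\<dots> \<le> (\<Sum>p\<in>{p\<in>P. v \<in> S p}. l p)"
      using fam by (intro sum_mono) (auto simp: box_family_def)
    finally show ?thesis
      using L[OF v] by linarith
  qed
  ultimately have "box_family V E K a' b' L"
    unfolding box_family_def by blast
  then show ?thesis
    by (rule local_boxI)
qed

section \<open>Colourings with few neighbours in each class\<close>

text \<open>Induction on \<open>V\<close>: at most \<open>D\<close> of the \<open>D + 1\<close>
  colours occur on the neighbours of the new vertex, so one colour is free.\<close>

lemma greedy_colouring:
  assumes "finite V"
    and sym: "\<And>u v. u \<in> V \<Longrightarrow> v \<in> V \<Longrightarrow> R u v \<Longrightarrow> R v u"
    and deg: "\<And>v. v \<in> V \<Longrightarrow> card {u\<in>V. u \<noteq> v \<and> R u v} \<le> D"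
  shows "\<exists>c :: 'a \<Rightarrow> nat. (\<forall>v\<in>V. c v \<le> D) \<and> (\<forall>u\<in>V. \<forall>v\<in>V. u \<noteq> v \<longrightarrow> R u v \<longrightarrow> c u \<noteq> c v)"
  using assms
proof (induction V rule: finite_induct)
  case empty
  then show ?case by simp
next
  case (insert x V)
  have deg: "card {u\<in>V. u \<noteq> v \<and> R u v} \<le> D" if "v \<in> V" for v
  proof -
    have "card {u\<in>V. u \<noteq> v \<and> R u v} \<le> card {u\<in>insert x V. u \<noteq> v \<and> R u v}"
      using insert.hyps by (intro card_mono) auto
    then show ?thesis
      using insert.prems(2)[of v] that by simp
  qed
  have "\<exists>c :: 'a \<Rightarrow> nat. (\<forall>v\<in>V. c v \<le> D) \<and> (\<forall>u\<in>V. \<forall>v\<in>V. u \<noteq> v \<longrightarrow> R u v \<longrightarrow> c u \<noteq> c v)"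
    using insert.prems(1) deg by (intro insert.IH) simp_all
  then obtain c :: "'a \<Rightarrow> nat" where c: "\<forall>v\<in>V. c v \<le> D"
    "\<forall>u\<in>V. \<forall>v\<in>V. u \<noteq> v \<longrightarrow> R u v \<longrightarrow> c u \<noteq> c v"
    by (elim exE conjE) (rule that)
  let ?N = "{u\<in>V. R u x}"
  have "card (c ` ?N) \<le> card ?N"
    using insert.hyps by (intro card_image_le) auto
  also have "card ?N \<le> card {u\<in>insert x V. u \<noteq> x \<and> R u x}"
    using insert.hyps by (intro card_mono) auto
  also have "\<dots> \<le> D"
    using insert.prems(2)[of x] by blast
  finally have "card (c ` ?N) < card {..D}"
    by simp
  then have "\<not> {..D} \<subseteq> c ` ?N"
    using insert.hyps card_mono[of "c ` ?N" "{..D}"] by fastforce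
  then obtain i where i: "i \<le> D" "i \<notin> c ` ?N"
    by blast
  have "(c(x := i)) u \<noteq> (c(x := i)) v" if "u \<in> insert x V" "v \<in> insert x V" "u \<noteq> v" "R u v" for u v
    using that c(2) i(2) insert.prems(1)[of u v] by (cases "u = x"; cases "v = x") auto
  moreover have "\<forall>v\<in>insert x V. (c(x := i)) v \<le> D"
    using c(1) i(1) by simp
  ultimately show ?case by blast
qed

section \<open>Colourings of uniform hypergraphs without monochromatic edges\<close>

text \<open>Only the edges inside \<open>S\<close> are constrained, so goodness passes to smaller
  vertex sets. Extensional functions make the colourings of \<open>S\<close> countable as a finite
  set.\<close>

definition good_colourings :: "'a set set \<Rightarrow> nat \<Rightarrow> 'a set \<Rightarrow> ('a \<Rightarrow> nat) set" where
  "good_colourings \<T> k S =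
     {c \<in> S \<rightarrow>\<^sub>E {..<k}. \<forall>T\<in>\<T>. T \<subseteq> S \<longrightarrow> \<not> (\<exists>i. \<forall>x\<in>T. c x = i)}"

lemma finite_good_colourings: "finite S \<Longrightarrow> finite (good_colourings \<T> k S)"
  unfolding good_colourings_def by (simp add: finite_PiE)

lemma good_colourings_restrict:
  assumes "c \<in> good_colourings \<T> k S" "R \<subseteq> S"
  shows "restrict c R \<in> good_colourings \<T> k R"
proof -
  have "\<not> (\<exists>i. \<forall>x\<in>T. restrict c R x = i)" if T: "T \<in> \<T>" "T \<subseteq> R" for T
  proof -
    have "restrict c R x = c x" if "x \<in> T" for x
      using T that by auto
    moreover have "\<not> (\<exists>i. \<forall>x\<in>T. c x = i)"
      using assms T unfolding good_colourings_def by blast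
    ultimately show ?thesis by simp
  qed
  moreover have "restrict c R \<in> R \<rightarrow>\<^sub>E {..<k}"
    using assms unfolding good_colourings_def by auto
  ultimately show ?thesis
    unfolding good_colourings_def by blast
qed

text \<open>Such a colouring is recovered from its restriction to \<open>S - T\<close> and from the
  colour of \<open>v\<close>, which is shared by all of \<open>T\<close>.\<close>

lemma card_monochromatic_le:
  assumes "finite S" "v \<notin> S" "v \<in> T" "T \<subseteq> insert v S"
  shows "card {c \<in> insert v S \<rightarrow>\<^sub>E {..<k}. restrict c S \<in> good_colourings \<T> k S \<and> (\<forall>x\<in>T. c x = c v)}
    \<le> card (good_colourings \<T> k (S - T)) * k"
proof -
  let ?B = "{c \<in> insert v S \<rightarrow>\<^sub>E {..<k}. restrict c S \<in> good_colourings \<T> k S \<and> (\<forall>x\<in>T. c x = c v)}"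
  let ?g = "\<lambda>c. (restrict c (S - T), c v)"
  have "inj_on ?g ?B"
  proof (rule inj_onI, rule ext)
    fix c c' x assume c: "c \<in> ?B" and c': "c' \<in> ?B" and eq: "?g c = ?g c'"
    consider "x \<in> T" | "x \<in> S - T" | "x \<notin> insert v S"
      using assms(3,4) by blast
    then show "c x = c' x"
    proof cases
      case 1
      with c c' eq show ?thesis by simp
    next
      case 2
      have "restrict c (S - T) x = restrict c' (S - T) x"
        using eq by (simp only: prod.inject)
      with 2 show ?thesis by simp
    next
      case 3
      then show ?thesis
        using c c' PiE_arb[of c "insert v S"] PiE_arb[of c' "insert v S"] by auto
    qed
  qed
  moreover have "?g ` ?B \<subseteq> good_colourings \<T> k (S - T) \<times> {..<k}"
  proof (rule image_subsetI)
    fix c assume "c \<in> ?B"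
    then have c: "c \<in> insert v S \<rightarrow>\<^sub>E {..<k}" "restrict c S \<in> good_colourings \<T> k S"
      by auto
    have "restrict c (S - T) = restrict (restrict c S) (S - T)"
      by (auto simp: restrict_def)
    then show "?g c \<in> good_colourings \<T> k (S - T) \<times> {..<k}"
      using c good_colourings_restrict[OF c(2), of "S - T"] by auto
  qed
  ultimately have "card ?B \<le> card (good_colourings \<T> k (S - T) \<times> {..<k})"
    using assms(1) by (intro card_inj_on_le[of ?g]) (simp_all add: finite_good_colourings)
  then show ?thesis
    by (simp add: card_cartesian_product)
qed

text \<open>Rosenfeld's counting argument, a substitute for the Lovasz local lemma.
  Among the \<open>k\<close>-fold extensions of the good colourings of \<open>S\<close>, those that make an edge \<open>T\<close>
  monochromatic come from good colourings of \<open>S - T\<close>, which by induction are fewer by a factor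
  \<open>(k/2)^d\<close>.\<close>
lemma card_good_colourings_insert:
  assumes "finite V" "insert v S \<subseteq> V" "v \<notin> S"
    and unif: "\<And>T. T \<in> \<T> \<Longrightarrow> T \<subseteq> V \<and> card T = Suc d"
    and deg: "\<And>v. v \<in> V \<Longrightarrow> card {T\<in>\<T>. v \<in> T} \<le> B"
    and k: "2 * B * 2 ^ d \<le> k ^ d"
  shows "k * card (good_colourings \<T> k S) \<le> 2 * card (good_colourings \<T> k (insert v S))"
  using assms(2,3)
proof (induction "card S" arbitrary: S v rule: less_induct)
  case less
  let ?N = "\<lambda>S. card (good_colourings \<T> k S)"
  have finS: "finite S"
    using less.prems(1) \<open>finite V\<close> finite_subset by auto
  have finT: "finite \<T>"
    using unif \<open>finite V\<close> by (intro finite_subset[of \<T> "Pow V"]) auto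
  \<comment> \<open>Putting the vertices of \<open>R\<close> back one at a time gains a factor of at
    least \<open>k / 2\<close> each, by the induction hypothesis for the smaller sets
    \<open>S - insert x R\<close>.\<close>
  have diff: "k ^ card R * ?N (S - R) \<le> 2 ^ card R * ?N S" if "R \<subseteq> S" for R
  proof -
    have "finite R"
      using that finS finite_subset by blast
    then show ?thesis
      using that
    proof (induction R rule: finite_induct)
      case empty
      then show ?case by simp
    next
      case (insert x R)
      have eq: "insert x (S - insert x R) = S - R"
        using insert by auto
      have "card (S - insert x R) < card S"
        using insert finS by (intro psubset_card_mono) auto
      then have "k * ?N (S - insert x R) \<le> 2 * ?N (S - R)"
        using less.hyps[of "S - insert x R" x] eq insert.prems less.prems(1) by auto
      then have "k ^ card R * (k * ?N (S - insert x R)) \<le> 2 * (k ^ card R * ?N (S - R))"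
        by (metis mult.left_commute mult_le_mono2)
      also have "\<dots> \<le> 2 * (2 ^ card R * ?N S)"
        using insert by auto
      finally show ?case
        using insert.hyps by (simp add: mult_ac)
    qed
  qed
  let ?ext = "{c \<in> insert v S \<rightarrow>\<^sub>E {..<k}. restrict c S \<in> good_colourings \<T> k S}"
  let ?bad = "\<lambda>T. {c \<in> insert v S \<rightarrow>\<^sub>E {..<k}. restrict c S \<in> good_colourings \<T> k S \<and> (\<forall>x\<in>T. c x = c v)}"
  let ?Ts = "{T\<in>\<T>. v \<in> T \<and> T \<subseteq> insert v S}"
  have fin_ext: "finite ?ext"
    using finS by (simp add: finite_PiE)
  \<comment> \<open>Every good colouring of \<open>S\<close> extends by each of the \<open>k\<close>
    colours at \<open>v\<close>. The extension determines it, because its own value at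
    \<open>v\<close> is \<open>undefined\<close>.\<close>
  have ext: "card (good_colourings \<T> k S \<times> {..<k}) \<le> card ?ext"
  proof (rule card_inj_on_le[OF _ _ fin_ext])
    let ?f = "\<lambda>(c, i). c(v := i)"
    have undef: "c v = undefined" if "c \<in> good_colourings \<T> k S" for c
      using that less.prems(2) by (auto simp: good_colourings_def PiE_def extensional_def)
    show "inj_on ?f (good_colourings \<T> k S \<times> {..<k})"
    proof (rule inj_onI, clarify)
      fix c i c' j assume c: "c \<in> good_colourings \<T> k S" "c' \<in> good_colourings \<T> k S"
        and eq: "c(v := i) = c'(v := j)"
      then have "i = j"
        by (metis fun_upd_same)
      moreover have "c = c'"
        using eq undef[OF c(1)] undef[OF c(2)] by (metis fun_upd_triv fun_upd_upd)
      ultimately show "c = c' \<and> i = j" by simp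
    qed
    show "?f ` (good_colourings \<T> k S \<times> {..<k}) \<subseteq> ?ext"
    proof (rule image_subsetI)
      fix p assume "p \<in> good_colourings \<T> k S \<times> {..<k}"
      then obtain c i where p: "p = (c, i)" and c: "c \<in> good_colourings \<T> k S" and i: "i \<in> {..<k}"
        by blast
      have cS: "c \<in> S \<rightarrow>\<^sub>E {..<k}"
        using c by (simp add: good_colourings_def)
      have "restrict (c(v := i)) S = restrict c S"
        using less.prems(2) by (intro restrict_ext) auto
      also have "\<dots> = c"
        using cS by (rule PiE_restrict)
      finally show "?f p \<in> ?ext"
        using c PiE_fun_upd[OF i cS] by (simp add: p)
    qed
  qed
  \<comment> \<open>An extension that is not good has a monochromatic edge, and this edge contains
    \<open>v\<close> because the restriction to \<open>S\<close> is good.\<close>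
  have "?ext \<subseteq> good_colourings \<T> k (insert v S) \<union> (\<Union>T\<in>?Ts. ?bad T)"
  proof (rule subsetI)
    fix c assume c: "c \<in> ?ext"
    show "c \<in> good_colourings \<T> k (insert v S) \<union> (\<Union>T\<in>?Ts. ?bad T)"
    proof (cases "c \<in> good_colourings \<T> k (insert v S)")
      case False
      then obtain T i where T: "T \<in> \<T>" "T \<subseteq> insert v S" "\<forall>x\<in>T. c x = i"
        using c unfolding good_colourings_def by blast
      have "v \<in> T"
      proof (rule ccontr)
        assume "v \<notin> T"
        then have "T \<subseteq> S" "\<forall>x\<in>T. restrict c S x = i"
          using T by auto
        then show False
          using c T(1) unfolding good_colourings_def by blast
      qed
      then have "T \<in> ?Ts" "c \<in> ?bad T"
        using T c by simp_all
      then show ?thesis by blast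
    qed blast
  qed
  then have "card ?ext \<le> card (good_colourings \<T> k (insert v S) \<union> (\<Union>T\<in>?Ts. ?bad T))"
    using finS finT by (intro card_mono) (simp_all add: finite_good_colourings finite_PiE)
  moreover have "\<dots> \<le> ?N (insert v S) + card (\<Union>T\<in>?Ts. ?bad T)"
    by (rule card_Un_le)
  moreover have "card (\<Union>T\<in>?Ts. ?bad T) \<le> (\<Sum>T\<in>?Ts. card (?bad T))"
    using finT by (intro card_UN_le) simp
  moreover have "card (good_colourings \<T> k S \<times> {..<k}) = k * ?N S"
    by (simp add: card_cartesian_product mult.commute)
  ultimately have main: "k * ?N S \<le> ?N (insert v S) + (\<Sum>T\<in>?Ts. card (?bad T))"
    using ext by linarith
  \<comment> \<open>Deleting the \<open>d\<close> vertices of \<open>T\<close> other than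
    \<open>v\<close> costs a factor \<open>(k / 2) ^ d\<close>; the common colour of
    \<open>T\<close> contributes one factor \<open>k\<close>.\<close>
  have "k ^ d * card (?bad T) \<le> k * 2 ^ d * ?N S" if "T \<in> ?Ts" for T
  proof -
    have T: "T \<in> \<T>" "v \<in> T" "T \<subseteq> insert v S"
      using that by auto
    have "S - T = S - (T - {v})"
      using less.prems(2) by auto
    moreover have "card (T - {v}) = d"
      using T unif[OF T(1)] by simp
    ultimately have "k ^ d * ?N (S - T) \<le> 2 ^ d * ?N S"
      using diff[of "T - {v}"] T(3) by auto
    then have le: "k ^ d * ?N (S - T) * k \<le> 2 ^ d * ?N S * k"
      by (rule mult_le_mono1)
    have "k ^ d * card (?bad T) \<le> k ^ d * (?N (S - T) * k)"
      by (rule mult_le_mono2[OF card_monochromatic_le[OF finS less.prems(2) T(2,3)]])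
    also have "\<dots> \<le> k * 2 ^ d * ?N S"
      using le by (simp only: mult_ac)
    finally show ?thesis .
  qed
  then have "(\<Sum>T\<in>?Ts. k ^ d * card (?bad T)) \<le> of_nat (card ?Ts) * (k * 2 ^ d * ?N S)"
    by (rule sum_bounded_above)
  moreover have "card ?Ts \<le> B"
  proof -
    have "card ?Ts \<le> card {T\<in>\<T>. v \<in> T}"
      using finT by (intro card_mono) auto
    then show ?thesis
      using deg[of v] less.prems(1) by simp
  qed
  then have "card ?Ts * (k * 2 ^ d * ?N S) \<le> B * (k * 2 ^ d * ?N S)"
    by (rule mult_le_mono1)
  ultimately have sum_le: "k ^ d * (\<Sum>T\<in>?Ts. card (?bad T)) \<le> B * (k * 2 ^ d * ?N S)"
    unfolding sum_distrib_left of_nat_id by (rule order_trans)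
  \<comment> \<open>The condition on \<open>k\<close>, \<open>B\<close> and \<open>d\<close> says
    that at most half of the \<open>k * ?N S\<close> extensions are bad.\<close>
  have "k ^ d * (2 * (\<Sum>T\<in>?Ts. card (?bad T))) \<le> (2 * B * 2 ^ d) * (k * ?N S)"
    using mult_le_mono2[OF sum_le, of 2] by (simp only: mult_ac)
  also have "\<dots> \<le> k ^ d * (k * ?N S)"
    by (rule mult_le_mono1[OF k])
  finally have bound: "k ^ d * (2 * (\<Sum>T\<in>?Ts. card (?bad T))) \<le> k ^ d * (k * ?N S)" .
  show ?case
  proof (cases "k = 0")
    case False
    then have "0 < k ^ d"
      by simp
    then have "2 * (\<Sum>T\<in>?Ts. card (?bad T)) \<le> k * ?N S"
      by (rule iffD1[OF nat_mult_le_cancel1 bound])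
    then show ?thesis
      using main by linarith
  qed simp
qed

text \<open>The number of good colourings starts at 1 for the empty set and grows by a factor of at
  least \<open>k / 2\<close> with every vertex, so it never vanishes.\<close>

lemma hypergraph_colouring:
  assumes "finite V" "0 < k"
    and unif: "\<And>T. T \<in> \<T> \<Longrightarrow> T \<subseteq> V \<and> card T = Suc d"
    and deg: "\<And>v. v \<in> V \<Longrightarrow> card {T\<in>\<T>. v \<in> T} \<le> B"
    and k: "2 * B * 2 ^ d \<le> k ^ d"
  shows "\<exists>c. (\<forall>v\<in>V. c v < k) \<and> (\<forall>T\<in>\<T>. \<not> (\<exists>i. \<forall>x\<in>T. c x = i))"
proof -
  have "0 < card (good_colourings \<T> k S)" if "finite S" "S \<subseteq> V" for S
    using that
  proof (induction S rule: finite_induct)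
    case empty
    have "T \<noteq> {}" if "T \<in> \<T>" for T
      using unif[OF that] by auto
    then have "good_colourings \<T> k {} = {\<lambda>_. undefined}"
      by (auto simp: good_colourings_def)
    then show ?case by simp
  next
    case (insert x S)
    then have "k * card (good_colourings \<T> k S) \<le> 2 * card (good_colourings \<T> k (insert x S))"
      using card_good_colourings_insert[OF assms(1) _ _ unif deg k] by blast
    moreover have "0 < k * card (good_colourings \<T> k S)"
      using insert \<open>0 < k\<close> by auto
    ultimately show ?case by linarith
  qed
  then have "good_colourings \<T> k V \<noteq> {}"
    using assms(1) by fastforce
  then obtain c where "c \<in> good_colourings \<T> k V"
    by blast
  then show ?thesis
    using unif unfolding good_colourings_def by (intro exI[of _ c]) auto
qed

section \<open>From hypergraph colourings to graph colourings with few neighbours per colour\<close>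

lemma power_le_fact: "real d ^ d \<le> 3 ^ d * fact d"
proof -
  \<comment> \<open>A single term of the exponential series at \<open>d\<close> is at most its sum,
    and \<open>exp 1 \<le> 3\<close>.\<close>
  have "(\<Sum>n\<in>{d}. real d ^ n /\<^sub>R fact n) \<le> exp (real d)"
    unfolding exp_def by (intro sum_le_suminf summable_exp_generic) auto
  then have "real d ^ d / fact d \<le> exp (real d)"
    by (simp add: divide_inverse mult.commute)
  also have "\<dots> = exp 1 ^ d"
    using exp_of_nat_mult[of d "1::real"] by simp
  also have "\<dots> \<le> 3 ^ d"
    by (intro power_mono exp_le) simp
  finally show ?thesis
    by (simp add: field_simps)
qed

text \<open>The familiar estimate of a binomial coefficient by \<open>(3 * n / d) ^ d\<close>,
  cleared of denominators.\<close>

lemma binomial_mult_power_le: "(n choose d) * d ^ d \<le> 3 ^ d * n ^ d"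
proof -
  have "d ^ d \<le> 3 ^ d * fact d"
    using power_le_fact[of d] by (metis (mono_tags, lifting) of_nat_fact of_nat_le_iff of_nat_mult of_nat_numeral of_nat_power)
  then have "(n choose d) * d ^ d \<le> 3 ^ d * ((n choose d) * fact d)"
    by (metis mult.left_commute mult_le_mono2)
  also have "\<dots> \<le> 3 ^ d * n ^ d"
    using binomial_fact_pow by simp
  finally show ?thesis .
qed

text \<open>The hypergraph consists of the sets of \<open>d + 1\<close> vertices with a common
  neighbour; a colour used more than \<open>d\<close> times around one vertex would make such a set
  monochromatic. An edge through \<open>v\<close> is given by a common neighbour \<open>w\<close>
  and \<open>d\<close> further neighbours of \<open>w\<close>, which yields the degree
  \<open>n * (n choose d)\<close>.\<close>

lemma bounded_colouring:
  assumes "finite V"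
    and deg: "\<And>v. v \<in> V \<Longrightarrow> card (nbhd V E v) \<le> n"
    and d: "2 * n \<le> 2 ^ d" "0 < d" and k: "12 * n \<le> k * d" "0 < k"
  shows "\<exists>c. (\<forall>v\<in>V. c v < k) \<and> (\<forall>v\<in>V. \<forall>i. card {u \<in> nbhd V E v. c u = i} \<le> d)"
proof -
  define \<T> where "\<T> = {T. \<exists>w\<in>V. T \<subseteq> nbhd V E w \<and> card T = Suc d}"
  have finN: "finite (nbhd V E w)" for w
    using assms(1) by (simp add: nbhd_def)
  have "T \<subseteq> V \<and> card T = Suc d" if "T \<in> \<T>" for T
    using that by (auto simp: \<T>_def nbhd_def)
  moreover have "card {T\<in>\<T>. v \<in> T} \<le> n * (n choose d)" if v: "v \<in> V" for v
  proof -
    let ?A = "\<lambda>w. insert v ` {T. T \<subseteq> nbhd V E w \<and> card T = d}"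
    have "{T\<in>\<T>. v \<in> T} \<subseteq> (\<Union>w\<in>nbhd V E v. ?A w)"
    proof clarify
      fix T assume "T \<in> \<T>" "v \<in> T"
      then obtain w where w: "w \<in> V" "T \<subseteq> nbhd V E w" "card T = Suc d"
        by (auto simp: \<T>_def)
      then have "w \<in> nbhd V E v"
        using \<open>v \<in> T\<close> by (auto simp: nbhd_def insert_commute)
      moreover have "T = insert v (T - {v})" "card (T - {v}) = d" "T - {v} \<subseteq> nbhd V E w"
        using w \<open>v \<in> T\<close> by auto
      ultimately show "T \<in> (\<Union>w\<in>nbhd V E v. ?A w)"
        by blast
    qed
    then have "card {T\<in>\<T>. v \<in> T} \<le> card (\<Union>w\<in>nbhd V E v. ?A w)"
      using finN by (intro card_mono) auto
    also have "\<dots> \<le> (\<Sum>w\<in>nbhd V E v. card (?A w))"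
      by (rule card_UN_le[OF finN])
    also have "\<dots> \<le> of_nat (card (nbhd V E v)) * (n choose d)"
    proof (rule sum_bounded_above)
      fix w assume w: "w \<in> nbhd V E v"
      have "card (?A w) \<le> card {T. T \<subseteq> nbhd V E w \<and> card T = d}"
        using finN by (intro card_image_le) auto
      also have "\<dots> = card (nbhd V E w) choose d"
        by (rule n_subsets[OF finN])
      also have "\<dots> \<le> n choose d"
        using deg[of w] w by (intro binomial_right_mono) (auto simp: nbhd_def)
      finally show "card (?A w) \<le> n choose d" .
    qed
    also have "\<dots> \<le> n * (n choose d)"
      using deg[OF v] by simp
    finally show ?thesis .
  qed
  \<comment> \<open>Here \<open>12 = 2 * 2 * 3\<close> arises: one 2 comes from
    \<open>2 * n \<le> 2 ^ d\<close>, one from the factor \<open>2 ^ d\<close> of the colouring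
    condition, and the 3 from the binomial estimate.\<close>
  moreover have "2 * (n * (n choose d)) * 2 ^ d \<le> k ^ d"
  proof -
    have "2 * (n * (n choose d)) * 2 ^ d * d ^ d = (2 * n) * 2 ^ d * ((n choose d) * d ^ d)"
      by (simp add: mult_ac)
    also have "\<dots> \<le> (2 * n) * 2 ^ d * (3 ^ d * n ^ d)"
      by (intro mult_le_mono2 binomial_mult_power_le)
    also have "\<dots> \<le> 2 ^ d * 2 ^ d * (3 ^ d * n ^ d)"
      using d(1) by (intro mult_le_mono1)
    also have "\<dots> = (12 * n) ^ d"
      unfolding power_mult_distrib[symmetric] by simp
    also have "\<dots> \<le> (k * d) ^ d"
      using k(1) by (intro power_mono) auto
    also have "\<dots> = k ^ d * d ^ d"
      by (simp add: power_mult_distrib)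
    finally show ?thesis
      using \<open>0 < d\<close> by simp
  qed
  ultimately obtain c where c: "\<forall>v\<in>V. c v < k" "\<forall>T\<in>\<T>. \<not> (\<exists>i. \<forall>x\<in>T. c x = i)"
    using hypergraph_colouring[OF assms(1) k(2), of \<T> d "n * (n choose d)"] by auto
  have "card {u \<in> nbhd V E v. c u = i} \<le> d" if "v \<in> V" for v i
  proof (rule ccontr)
    assume "\<not> ?thesis"
    then have "Suc d \<le> card {u \<in> nbhd V E v. c u = i}"
      by simp
    then obtain T where T: "T \<subseteq> {u \<in> nbhd V E v. c u = i}" "card T = Suc d"
      by (rule obtain_subset_with_card_n)
    then have "T \<in> \<T>"
      using that unfolding \<T>_def by blast
    then have "\<not> (\<exists>i. \<forall>x\<in>T. c x = i)"
      using bspec[OF c(2)] by blast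
    moreover have "\<forall>x\<in>T. c x = i"
      using T(1) by auto
    ultimately show False by simp
  qed
  then show ?thesis
    using c(1) by blast
qed

text \<open>Any two vertices lie together in the union of their two colour classes, so the pieces
  determine the graph, and each vertex lies in only \<open>k\<close> of them.\<close>

lemma local_box_colour_pairs:
  fixes c :: "'a \<Rightarrow> nat"
  assumes "finite V" and c: "\<And>v. v \<in> V \<Longrightarrow> c v < k"
    and box: "\<And>i j. local_box {v\<in>V. c v = i \<or> c v = j} E l"
  shows "local_box V E (k * l)"
proof (rule local_box_combine)
  \<comment> \<open>The diagonal pairs cover vertices of equal colour even when
    \<open>k = 1\<close>; with them, each colour belongs to exactly \<open>k\<close> pairs.\<close>
  let ?P = "{..<k} \<times> {..<k} \<inter> {(i, j). i \<le> j}"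
  let ?S = "\<lambda>p. {v\<in>V. c v = fst p \<or> c v = snd p}"
  show "finite V" "finite ?P"
    using assms(1) by auto
  show "?S p \<subseteq> V" for p
    by auto
  show "local_box (?S p) E l" for p
    using box by simp
  show "{u, v} \<in> E \<longleftrightarrow> (\<forall>p\<in>?P. u \<in> ?S p \<longrightarrow> v \<in> ?S p \<longrightarrow> {u, v} \<in> E)" if "u \<in> V" "v \<in> V" for u v
  proof -
    have "(min (c u) (c v), max (c u) (c v)) \<in> ?P"
      using c[OF that(1)] c[OF that(2)] by (auto simp: min_def max_def)
    moreover have "u \<in> ?S (min (c u) (c v), max (c u) (c v))" "v \<in> ?S (min (c u) (c v), max (c u) (c v))"
      using that by (auto simp: min_def max_def)
    ultimately show ?thesis by blast
  qed
  show "(\<Sum>p\<in>{p\<in>?P. v \<in> ?S p}. l) \<le> k * l" if "v \<in> V" for v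
  proof -
    have "{p\<in>?P. v \<in> ?S p} \<subseteq> (\<lambda>i. (min i (c v), max i (c v))) ` {..<k}"
    proof
      fix p assume "p \<in> {p\<in>?P. v \<in> ?S p}"
      then obtain i j where ij: "p = (i, j)" "i \<le> j" "i < k" "j < k" "c v = i \<or> c v = j"
        by auto
      then have "p = (min i (c v), max i (c v)) \<or> p = (min j (c v), max j (c v))"
        by auto
      then show "p \<in> (\<lambda>i. (min i (c v), max i (c v))) ` {..<k}"
        using ij by blast
    qed
    then have "card {p\<in>?P. v \<in> ?S p} \<le> card {..<k}"
      by (meson card_image_le card_mono finite_imageI finite_lessThan order_trans)
    then show ?thesis by simp
  qed
qed

text \<open>Every component is a vertex or an edge, that is, a closed neighbourhood. Numbering these
  injectively gives one-point intervals that coincide exactly within components.\<close>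

lemma local_box_matching:
  assumes "finite V" and deg: "\<And>v. v \<in> V \<Longrightarrow> card (nbhd V E v) \<le> 1"
  shows "local_box V E 1"
proof -
  obtain h :: "'a set \<Rightarrow> nat" where h: "inj_on h (Pow V)"
    using assms(1) by (meson finite_Pow_iff finite_imp_inj_to_nat_seg)
  define g where "g v = real (h (insert v (nbhd V E v)))" for v
  have "{u, v} \<in> E \<longleftrightarrow> g u = g v" if uv: "u \<in> V" "v \<in> V" "u \<noteq> v" for u v
  proof
    assume E: "{u, v} \<in> E"
    have single: "nbhd V E x = {y}" if "x \<in> V" "y \<in> nbhd V E x" for x y
    proof -
      have "finite (nbhd V E x)"
        using assms(1) by (simp add: nbhd_def)
      then have "\<forall>z\<in>nbhd V E x. z = y"
        using deg[OF that(1)] that(2) by (simp add: card_le_Suc0_iff_eq)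
      then show ?thesis
        using that(2) by blast
    qed
    have "nbhd V E u = {v}"
      using uv E by (intro single) (auto simp: nbhd_def insert_commute)
    moreover have "nbhd V E v = {u}"
      using uv E by (intro single) (auto simp: nbhd_def insert_commute)
    ultimately show "g u = g v"
      by (simp add: g_def insert_commute)
  next
    assume "g u = g v"
    then have "insert u (nbhd V E u) = insert v (nbhd V E v)"
      using h uv unfolding g_def by (auto simp: inj_on_def nbhd_def)
    then have "u \<in> nbhd V E v"
      using uv by auto
    then show "{u, v} \<in> E"
      by (simp add: nbhd_def)
  qed
  then show ?thesis
    by (intro local_box_interval[of V g g]) (auto simp: overlap_def)
qed

text \<open>\<open>R\<close> is adjacency in the square of the graph, where degrees are at most
  \<open>n * n + n\<close>; the greedy colouring uses one colour more.\<close>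

lemma local_box_degree_square:
  assumes "finite V" and deg: "\<And>v. v \<in> V \<Longrightarrow> card (nbhd V E v) \<le> n"
  shows "local_box V E (n * n + n + 1)"
proof -
  have finN: "finite (nbhd V E w)" for w
    using assms(1) by (simp add: nbhd_def)
  define R where "R u v \<longleftrightarrow> u \<in> nbhd V E v \<or> (\<exists>w\<in>nbhd V E v. u \<in> nbhd V E w)" for u v
  have sym: "R v u" if "u \<in> V" "v \<in> V" "R u v" for u v
    using that unfolding R_def nbhd_def by (auto simp: insert_commute)
  have deg2: "card {u\<in>V. u \<noteq> v \<and> R u v} \<le> n * n + n" if v: "v \<in> V" for v
  proof -
    have "card {u\<in>V. u \<noteq> v \<and> R u v} \<le> card (nbhd V E v \<union> (\<Union>w\<in>nbhd V E v. nbhd V E w))"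
      using finN by (intro card_mono) (auto simp: R_def)
    moreover have "\<dots> \<le> card (nbhd V E v) + card (\<Union>w\<in>nbhd V E v. nbhd V E w)"
      by (rule card_Un_le)
    moreover have "card (\<Union>w\<in>nbhd V E v. nbhd V E w) \<le> (\<Sum>w\<in>nbhd V E v. card (nbhd V E w))"
      by (rule card_UN_le[OF finN])
    moreover have "\<dots> \<le> of_nat (card (nbhd V E v)) * n"
      using deg by (intro sum_bounded_above) (simp add: nbhd_def)
    moreover have "of_nat (card (nbhd V E v)) * n \<le> n * n"
      using deg[OF v] by simp
    ultimately show ?thesis
      using deg[OF v] by linarith
  qed
  have "\<exists>c :: 'a \<Rightarrow> nat. (\<forall>v\<in>V. c v \<le> n * n + n) \<and>
      (\<forall>u\<in>V. \<forall>v\<in>V. u \<noteq> v \<longrightarrow> R u v \<longrightarrow> c u \<noteq> c v)"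
    using assms(1) sym deg2 by (rule greedy_colouring)
  then obtain c where c: "\<forall>v\<in>V. c v \<le> n * n + n"
    "\<forall>u\<in>V. \<forall>v\<in>V. u \<noteq> v \<longrightarrow> R u v \<longrightarrow> c u \<noteq> c v"
    by (elim exE conjE) (rule that)
  have "local_box {v\<in>V. c v = i \<or> c v = j} E 1" for i j
  proof (rule local_box_matching)
    let ?S = "{v\<in>V. c v = i \<or> c v = j}"
    show "finite ?S"
      using assms(1) by simp
    fix v assume v: "v \<in> ?S"
    \<comment> \<open>Otherwise \<open>x\<close>, \<open>v\<close>, \<open>y\<close> form a path,
      whose three vertices have distinct colours although only \<open>i\<close> and \<open>j\<close>
      occur.\<close>
    have "x = y" if x: "x \<in> nbhd ?S E v" and y: "y \<in> nbhd ?S E v" for x y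
    proof (rule ccontr)
      assume "x \<noteq> y"
      have N: "x \<in> nbhd V E v" "y \<in> nbhd V E v" "v \<in> nbhd V E y" "x \<in> V" "y \<in> V" "x \<noteq> v" "y \<noteq> v"
        using x y v by (auto simp: nbhd_def insert_commute)
      then have "R x v" "R y v" "R x y"
        by (auto simp: R_def)
      then have "c x \<noteq> c v" "c y \<noteq> c v" "c x \<noteq> c y"
        using c(2) N v \<open>x \<noteq> y\<close> by auto
      moreover have "c x = i \<or> c x = j" "c y = i \<or> c y = j" "c v = i \<or> c v = j"
        using x y v by (auto simp: nbhd_def)
      ultimately show False by auto
    qed
    then show "card (nbhd ?S E v) \<le> 1"
      using assms(1) by (simp add: card_le_Suc0_iff_eq nbhd_def)
  qed
  then have "local_box V E ((n * n + n + 1) * 1)"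
    using c(1) by (intro local_box_colour_pairs[OF assms(1), of c]) (auto simp: less_Suc_eq_le)
  then show ?thesis by simp
qed

text \<open>In the union of two colour classes a vertex keeps at most \<open>d\<close> neighbours of
  each colour, so the degree drops from \<open>n\<close> to \<open>2 * d\<close>.\<close>

lemma local_box_degree_step:
  assumes "finite V"
    and deg: "\<And>v. v \<in> V \<Longrightarrow> card (nbhd V E v) \<le> n"
    and d: "2 * n \<le> 2 ^ d" "0 < d" and k: "12 * n \<le> k * d" "0 < k"
    and box: "\<And>S. S \<subseteq> V \<Longrightarrow> (\<And>v. v \<in> S \<Longrightarrow> card (nbhd S E v) \<le> 2 * d) \<Longrightarrow> local_box S E l"
  shows "local_box V E (k * l)"
proof -
  obtain c where c: "\<forall>v\<in>V. c v < k" "\<forall>v\<in>V. \<forall>i. card {u \<in> nbhd V E v. c u = i} \<le> d"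
    using bounded_colouring[OF assms(1) deg d k] by blast
  have "local_box {v\<in>V. c v = i \<or> c v = j} E l" for i j
  proof (rule box)
    let ?S = "{v\<in>V. c v = i \<or> c v = j}"
    show "?S \<subseteq> V" by auto
    fix v assume v: "v \<in> ?S"
    have "card (nbhd ?S E v) \<le> card ({u \<in> nbhd V E v. c u = i} \<union> {u \<in> nbhd V E v. c u = j})"
      using assms(1) by (intro card_mono) (auto simp: nbhd_def)
    also have "\<dots> \<le> card {u \<in> nbhd V E v. c u = i} + card {u \<in> nbhd V E v. c u = j}"
      by (rule card_Un_le)
    also have "\<dots> \<le> 2 * d"
      using c(2) v add_mono[of "card {u \<in> nbhd V E v. c u = i}" d "card {u \<in> nbhd V E v. c u = j}" d]
      by (simp add: mult_2)
    finally show "card (nbhd ?S E v) \<le> 2 * d" .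
  qed
  then show ?thesis
    using c(1) by (intro local_box_colour_pairs[OF assms(1), of c]) auto
qed

section \<open>The upper bound\<close>

lemma log2_le_diff_one:
  assumes "2 \<le> x"
  shows "log 2 x \<le> x - 1"
proof -
  \<comment> \<open>This is the tangent of \<open>ln\<close> at 2; its slope \<open>1 / 2\<close> is
    then enlarged to \<open>ln 2\<close>.\<close>
  have "ln (x / 2) \<le> x / 2 - 1"
    using assms by (intro ln_le_minus_one) auto
  then have "ln x \<le> ln 2 + (x - 2) / 2"
    using assms by (simp add: ln_div diff_divide_distrib)
  also have "(x - 2) / 2 \<le> (x - 2) * ln 2"
    using mult_left_mono[of "1/2" "ln 2" "x - 2"] ln2_ge_two_thirds assms by simp
  finally have "ln x \<le> (x - 1) * ln 2"
    by (simp add: algebra_simps)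
  then show ?thesis
    by (simp add: log_def divide_simps)
qed

text \<open>Above 2 a logarithm lowers the value by at least 1, so the rounded value descends;
  between 1 and 2 one logarithm suffices. This ensures that the minimum defining
  \<open>log_star\<close> is attained.\<close>

lemma ex_log_iterate_le_one: "\<exists>k. (log 2 ^^ k) x \<le> 1"
proof (induction "nat \<lceil>x\<rceil>" arbitrary: x rule: less_induct)
  case less
  show ?case
  proof (cases "x \<le> 2")
    case True
    show ?thesis
    proof (cases "x \<le> 1")
      case True
      then show ?thesis by (intro exI[of _ 0]) simp
    next
      case False
      then have "log 2 x \<le> log 2 2"
        using \<open>x \<le> 2\<close> by (subst log_le_cancel_iff) auto
      then show ?thesis by (intro exI[of _ 1]) simp
    qed
  next
    case False
    then have "nat \<lceil>log 2 x\<rceil> < nat \<lceil>x\<rceil>"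
      using log2_le_diff_one[of x] by linarith
    then obtain k where "(log 2 ^^ k) (log 2 x) \<le> 1"
      using less by blast
    then show ?thesis
      by (intro exI[of _ "Suc k"]) (simp add: funpow_swap1)
  qed
qed

lemma log_star_eq_0: "x \<le> 1 \<Longrightarrow> log_star x = 0"
  unfolding log_star_def by (simp add: Least_eq_0)

lemma log_star_log:
  assumes "1 < x"
  shows "log_star x = Suc (log_star (log 2 x))"
proof -
  obtain k where "(log 2 ^^ k) x \<le> 1"
    using ex_log_iterate_le_one by blast
  then have "log_star x = Suc (LEAST k. (log 2 ^^ Suc k) x \<le> 1)"
    unfolding log_star_def using assms by (intro Least_Suc) auto
  then show ?thesis
    by (simp add: log_star_def funpow_swap1)
qed

text \<open>The induction follows the recursion of \<open>log_star\<close> and takes logarithms only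
  of values above 1, where \<open>log 2\<close> is monotone.\<close>

lemma log_star_mono:
  assumes "x \<le> y"
  shows "log_star x \<le> log_star y"
  using assms
proof (induction "log_star y" arbitrary: x y)
  case 0
  then have "y \<le> 1"
    using log_star_log[of y] by (cases "y \<le> 1") auto
  then show ?case
    using \<open>x \<le> y\<close> by (simp add: log_star_eq_0)
next
  case (Suc n)
  then have y: "1 < y"
    using log_star_eq_0[of y] by (cases "y \<le> 1") auto
  show ?case
  proof (cases "x \<le> 1")
    case True
    then show ?thesis by (simp add: log_star_eq_0)
  next
    case False
    then have "log 2 x \<le> log 2 y"
      using Suc.prems by (subst log_le_cancel_iff) auto
    moreover have "n = log_star (log 2 y)"
      using Suc.hyps(2) log_star_log[OF y] by simp
    ultimately show ?thesis
      using Suc.hyps(1) log_star_log[OF y] log_star_log[of x] False by simp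
  qed
qed

section \<open>Local boxicity in terms of the maximum degree\<close>

text \<open>The dummy argument fixes the vertex type, which otherwise occurs only in bound
  variables.\<close>

definition degree_bound :: "'a itself \<Rightarrow> nat \<Rightarrow> nat \<Rightarrow> bool" where
  "degree_bound _ n l \<longleftrightarrow> (\<forall>(V :: 'a set) E. finite V \<longrightarrow> (\<forall>v\<in>V. card (nbhd V E v) \<le> n) \<longrightarrow> local_box V E l)"

lemma degree_bound_step:
  assumes "4 \<le> n"
  obtains d k where "2 \<le> d" "real d \<le> log 2 (real n) + 2" "real k \<le> 13 * real n / real d"
    and "\<And>l. degree_bound TYPE('a) (2 * d) l \<Longrightarrow> degree_bound TYPE('a) n (k * l)"
proof -
  define L where "L = log 2 (real n)"
  \<comment> \<open>The summand 1 provides the factor 2 in \<open>2 * n \<le> 2 ^ d\<close>.\<close>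
  define d where "d = nat \<lceil>L\<rceil> + 1"
  \<comment> \<open>The least number with \<open>12 * n < k * d\<close>. Rounding adds at most
    \<open>1 \<le> n / d\<close>, which turns 12 into 13.\<close>
  define k where "k = 12 * n div d + 1"
  have nL: "real n = 2 powr L"
    using assms by (simp add: L_def)
  have "log 2 4 \<le> L"
    unfolding L_def using assms by (subst log_le_cancel_iff) auto
  moreover have "log 2 (4::real) = 2"
    using log_pow_cancel[of 2 2] by simp
  ultimately have L2: "2 \<le> L" by simp
  have d_ge: "L + 1 \<le> real d" and d_le: "real d \<le> L + 2"
    unfolding d_def using L2 by linarith+
  have "2 * real n = 2 powr (L + 1)"
    by (simp add: nL powr_add)
  also have "\<dots> \<le> 2 powr real d"
    using d_ge by (intro powr_mono) auto
  also have "\<dots> = real (2 ^ d)"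
    by (simp add: powr_realpow)
  finally have d_pow: "2 * n \<le> 2 ^ d"
    by linarith
  \<comment> \<open>With \<open>4 \<le> n\<close> this gives
    \<open>d \<le> L + 2 \<le> n / 2 + 2 \<le> n\<close>.\<close>
  have "L \<le> real n / 2"
  proof -
    have "log 2 (real n / 2) \<le> real n / 2 - 1"
      using assms by (intro log2_le_diff_one) auto
    then show ?thesis
      using assms by (simp add: L_def log_divide)
  qed
  then have "real d \<le> real n"
    using d_le assms by linarith
  have "real k \<le> 12 * real n / real d + 1"
    unfolding k_def using of_nat_div_le_of_nat[of "12 * n" d, where ?'a=real] by simp
  also have "\<dots> \<le> 13 * real n / real d"
    using \<open>real d \<le> real n\<close> d_ge L2 by (simp add: field_simps)
  finally have k_le: "real k \<le> 13 * real n / real d" .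
  have "12 * n < k * d"
    unfolding k_def using dividend_less_div_times[of d "12 * n"] by (simp add: d_def)
  then have "degree_bound TYPE('a) n (k * l)" if "degree_bound TYPE('a) (2 * d) l" for l
    unfolding degree_bound_def
  proof (intro allI impI)
    fix V :: "'a set" and E
    assume V: "finite V" "\<forall>v\<in>V. card (nbhd V E v) \<le> n"
    show "local_box V E (k * l)"
    proof (rule local_box_degree_step[OF V(1) _ d_pow])
      show "local_box S E l" if "S \<subseteq> V" "\<And>v. v \<in> S \<Longrightarrow> card (nbhd S E v) \<le> 2 * d" for S
        using \<open>degree_bound TYPE('a) (2 * d) l\<close> that V(1) finite_subset[of S V]
        unfolding degree_bound_def by blast
    qed (use V(2) \<open>12 * n < k * d\<close> in \<open>auto simp: d_def k_def\<close>)
  qed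
  moreover have "2 \<le> d"
    using d_ge L2 by linarith
  ultimately show ?thesis
    using that d_le k_le unfolding L_def by blast
qed

text \<open>For \<open>L = log 2 n\<close>, one colouring step leaves degree at most
  \<open>2 * L + 4\<close>, and a second one at most the left-hand side. The proof uses the tangent
  of \<open>ln\<close> at \<open>32 = 2 ^ 5\<close>, near the value 36 of \<open>2 * L + 4\<close>
  at \<open>L = 16\<close>.\<close>

lemma log2_affine_bound:
  assumes "16 \<le> L"
  shows "2 * log 2 (2 * L + 4) + 4 \<le> L"
proof -
  define x where "x = 2 * L + 4"
  have "ln (x / 32) \<le> x / 32 - 1"
    using assms by (intro ln_le_minus_one) (auto simp: x_def)
  moreover have "ln (32 :: real) = 5 * ln 2"
    using ln_realpow[of 2 5] by simp
  ultimately have "ln x \<le> 5 * ln 2 + (x / 32 - 1)"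
    using assms by (simp add: ln_div x_def)
  also have "x / 32 - 1 = (3 / 2 * (x / 32 - 1)) * (2 / 3)"
    by simp
  also have "\<dots> \<le> (3 / 2 * (x / 32 - 1)) * ln 2"
    using ln2_ge_two_thirds assms by (intro mult_left_mono) (auto simp: x_def)
  finally have "ln x \<le> (5 + 3 / 2 * (x / 32 - 1)) * ln 2"
    by (simp add: algebra_simps)
  then have "log 2 x \<le> 5 + 3 / 2 * (x / 32 - 1)"
    by (simp add: log_def divide_simps)
  then show ?thesis
    using assms unfolding x_def by (simp add: field_simps)
qed

text \<open>Two applications of the colouring step bring the degree below \<open>log n\<close>, at the cost of a
  factor \<open>26\<^sup>2 \<le> 2 ^ 13\<close> in the ratio of local boxicity and degree.\<close>
lemma degree_bound_log_star:
  assumes "1 \<le> n"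
  shows "\<exists>l\<ge>1. degree_bound TYPE('a) n l \<and> real l \<le> 2 ^ (13 * log_star (real n)) * real n"
  using assms
proof (induction n rule: less_induct)
  case (less n)
  have square: "degree_bound TYPE('a) n (n * n + n + 1)"
    unfolding degree_bound_def using local_box_degree_square by blast
  \<comment> \<open>At \<open>n = 1\<close> the claimed bound is 1, which requires matchings. Below
    \<open>2 ^ 16\<close> the quadratic bound suffices; from there on \<open>16 \<le> L\<close>, as
    \<open>log2_affine_bound\<close> demands.\<close>
  consider "n = 1" | "n = 2" | "3 \<le> n" "n < 2 ^ 16" | "2 ^ 16 \<le> n"
    using less.prems by linarith
  then show ?case
  proof cases
    case 1
    then show ?thesis
      unfolding degree_bound_def using local_box_matching by (intro exI[of _ 1]) (auto simp: log_star_eq_0)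
  next
    case 2
    have "log_star (real n) = 1"
      by (simp add: 2 log_star_log log_star_eq_0)
    then show ?thesis
      using square by (intro exI[of _ "n * n + n + 1"]) (simp add: 2)
  next
    case 3
    have "1 < log 2 (real n)"
      using 3 by (subst less_log_iff) auto
    then have "2 \<le> log_star (real n)"
      using 3 log_star_log[of "real n"] log_star_log[of "log 2 (real n)"] by simp
    then have "(2::real) ^ 26 \<le> 2 ^ (13 * log_star (real n))"
      by (intro power_increasing) auto
    moreover have "real n + 2 \<le> 2 ^ 26"
      using 3 by simp
    ultimately have "(real n + 2) * real n \<le> 2 ^ (13 * log_star (real n)) * real n"
      by (intro mult_right_mono) auto
    moreover have "real (n * n + n + 1) \<le> (real n + 2) * real n"
      using 3 by (simp add: algebra_simps)
    ultimately show ?thesis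
      using square by (intro exI[of _ "n * n + n + 1"]) auto
  next
    case 4
    define L where "L = log 2 (real n)"
    have "(2::real) ^ 16 \<le> real n"
      using 4 by simp
    then have L: "16 \<le> L"
      unfolding L_def using 4 by (subst le_log_iff) (auto simp: powr_numeral)
    obtain d k where d: "2 \<le> d" "real d \<le> L + 2" and k: "real k \<le> 13 * real n / real d"
      and step: "\<And>l. degree_bound TYPE('a) (2 * d) l \<Longrightarrow> degree_bound TYPE('a) n (k * l)"
      using degree_bound_step[of n] 4 unfolding L_def by auto
    obtain d' k' where d': "2 \<le> d'" "real d' \<le> log 2 (real (2 * d)) + 2"
      and k': "real k' \<le> 13 * real (2 * d) / real d'"
      and step': "\<And>l. degree_bound TYPE('a) (2 * d') l \<Longrightarrow> degree_bound TYPE('a) (2 * d) (k' * l)"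
      using degree_bound_step[of "2 * d"] d(1) by auto
    have "log 2 (real (2 * d)) \<le> log 2 (2 * L + 4)"
      using d by (subst log_le_cancel_iff) auto
    then have d'L: "real (2 * d') \<le> L"
      using d'(2) log2_affine_bound[OF L] by simp
    have "L < real n"
      using log2_le_diff_one[of "real n"] 4 by (simp add: L_def)
    then have "2 * d' < n"
      using d'L by linarith
    then obtain l where l: "l \<ge> 1" "degree_bound TYPE('a) (2 * d') l"
      "real l \<le> 2 ^ (13 * log_star (real (2 * d'))) * real (2 * d')"
      using less.IH[of "2 * d'"] d'(1) by auto
    define s where "s = log_star L"
    have s: "log_star (real n) = Suc s"
      using 4 by (simp add: s_def L_def log_star_log)
    have "(2::real) ^ (13 * log_star (real (2 * d'))) \<le> 2 ^ (13 * s)"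
      unfolding s_def using log_star_mono[OF d'L] by (intro power_increasing) auto
    then have l_le: "real l \<le> 2 ^ (13 * s) * real (2 * d')"
      using l(3) mult_right_mono[of _ _ "real (2 * d')"] by (meson of_nat_0_le_iff order_trans)
    have "real (k * (k' * l)) = real k * (real k' * real l)"
      by simp
    also have "\<dots> \<le> (13 * real n / real d) * ((13 * real (2 * d) / real d') * (2 ^ (13 * s) * real (2 * d')))"
      using k k' l_le by (intro mult_mono) auto
    \<comment> \<open>The degrees \<open>d\<close> and \<open>d'\<close> cancel, leaving
      \<open>26 * 26 = 676\<close>; the one logarithm between \<open>n\<close> and \<open>L\<close>
      pays for it with \<open>2 ^ 13\<close>.\<close>
    also have "\<dots> = 676 * 2 ^ (13 * s) * real n"
      using d(1) d'(1) by (simp add: field_simps)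
    also have "\<dots> \<le> 2 ^ 13 * 2 ^ (13 * s) * real n"
      by (intro mult_right_mono) auto
    also have "\<dots> = 2 ^ (13 * log_star (real n)) * real n"
      by (simp add: s power_add)
    finally have bound: "real (k * (k' * l)) \<le> 2 ^ (13 * log_star (real n)) * real n" .
    have "1 * 1 \<le> 2 ^ (13 * log_star (real n)) * real n"
      using 4 by (intro mult_mono) auto
    then have "real (max 1 (k * (k' * l))) \<le> 2 ^ (13 * log_star (real n)) * real n"
      using bound by (simp add: max_def)
    moreover have "degree_bound TYPE('a) n (max 1 (k * (k' * l)))"
      using step[OF step'[OF l(2)]] unfolding degree_bound_def
      by (meson local_box_mono max.cobounded2)
    ultimately show ?thesis
      by (intro exI[of _ "max 1 (k * (k' * l))"]) auto
  qed
qed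

section \<open>Splitting off the vertices of large degree\<close>

lemma sum_degrees_le:
  assumes "simple_graph V E"
  shows "(\<Sum>v\<in>V. card (nbhd V E v)) \<le> 2 * card E"
proof -
  have fin: "finite V" and E: "\<And>e. e \<in> E \<Longrightarrow> e \<subseteq> V \<and> card e = 2"
    using assms by (auto simp: simple_graph_def)
  have finE: "finite E"
    using E fin by (intro finite_subset[of E "Pow V"]) auto
  have "card (nbhd V E v) \<le> card {e\<in>E. v \<in> e}" for v
  proof (rule card_inj_on_le)
    show "inj_on (\<lambda>u. {u, v}) (nbhd V E v)"
      by (auto simp: inj_on_def doubleton_eq_iff)
    show "(\<lambda>u. {u, v}) ` nbhd V E v \<subseteq> {e\<in>E. v \<in> e}"
      by (auto simp: nbhd_def)
    show "finite {e\<in>E. v \<in> e}"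
      using finE by simp
  qed
  then have "(\<Sum>v\<in>V. card (nbhd V E v)) \<le> (\<Sum>v\<in>V. card {e\<in>E. v \<in> e})"
    by (rule sum_mono)
  also have "\<dots> = 2 * card E"
  proof (rule sum_multicount[OF fin finE], rule ballI)
    fix e assume "e \<in> E"
    then have "{v\<in>V. v \<in> e} = e"
      using E by auto
    then show "card {v\<in>V. v \<in> e} = 2"
      using E \<open>e \<in> E\<close> by simp
  qed
  finally show ?thesis .
qed

text \<open>The vertex \<open>h\<close> gets the point 0, its neighbours get the interval from 0 to
  1, and all other vertices get the point 1.\<close>

lemma local_box_star:
  "local_box V {{u, v} | u v. {u, v} \<in> E \<or> h \<notin> {u, v}} 1" (is "local_box V ?H 1")
proof (rule local_box_interval)
  let ?a = "\<lambda>v. if v = h \<or> {v, h} \<in> E then 0 else 1 :: real"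
  let ?b = "\<lambda>v. if v = h then 0 else 1 :: real"
  show "?a v \<le> ?b v" for v
    by simp
  have H: "{u, v} \<in> ?H \<longleftrightarrow> {u, v} \<in> E \<or> h \<notin> {u, v}" for u v
    by (auto simp: doubleton_eq_iff insert_commute)
  show "{u, v} \<in> ?H \<longleftrightarrow> overlap ?a ?b u v" if "u \<noteq> v" for u v
    unfolding H using that by (auto simp: overlap_def insert_commute)
qed

text \<open>Pairs that meet \<open>X\<close> are decided by the star-shaped graphs of the vertices
  in \<open>X\<close>, each costing 1; the index \<open>None\<close> stands for the representation
  of the rest.\<close>

lemma local_box_remove_vertices:
  assumes "finite V" and "X \<subseteq> V" and box: "local_box (V - X) E l"
  shows "local_box V E (l + card X)"
proof (rule local_box_combine)
  let ?H = "\<lambda>h. {{u, v} | u v. {u, v} \<in> E \<or> h \<notin> {u, v}}"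
  let ?P = "insert None (Some ` X)"
  let ?S = "\<lambda>p. case p of None \<Rightarrow> V - X | Some h \<Rightarrow> V"
  let ?E = "\<lambda>p. case p of None \<Rightarrow> E | Some h \<Rightarrow> ?H h"
  let ?l = "\<lambda>p. case p of None \<Rightarrow> l | Some h \<Rightarrow> 1"
  have "finite X"
    using assms finite_subset by blast
  then show "finite V" "finite ?P"
    using assms(1) by auto
  show "?S p \<subseteq> V" for p
    by (cases p) auto
  show "local_box (?S p) (?E p) (?l p)" for p
  proof (cases p)
    case None
    then show ?thesis using box by simp
  next
    case (Some h)
    then show ?thesis using local_box_star by auto
  qed
  have H: "{u, v} \<in> ?H h \<longleftrightarrow> {u, v} \<in> E \<or> h \<notin> {u, v}" for u v h
    by (auto simp: doubleton_eq_iff insert_commute)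
  show "{u, v} \<in> E \<longleftrightarrow> (\<forall>p\<in>?P. u \<in> ?S p \<longrightarrow> v \<in> ?S p \<longrightarrow> {u, v} \<in> ?E p)"
    if "u \<in> V" "v \<in> V" for u v
    using that by (auto simp: H)
  show "(\<Sum>p\<in>{p\<in>?P. v \<in> ?S p}. ?l p) \<le> l + card X" for v
  proof -
    have "(\<Sum>p\<in>{p\<in>?P. v \<in> ?S p}. ?l p) \<le> (\<Sum>p\<in>?P. ?l p)"
      using \<open>finite X\<close> by (intro sum_mono2) auto
    also have "\<dots> = l + card X"
      using \<open>finite X\<close> by (subst sum.insert) (auto simp: sum.reindex)
    finally show ?thesis .
  qed
qed

lemma lbox_upper_bound:
  fixes V :: "'a set"
  assumes graph: "simple_graph V E" and m: "1 \<le> card E"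
  shows "real (lbox V E) \<le> (2 ^ (13 * log_star (sqrt (real (card E)))) + 2) * sqrt (real (card E))"
proof -
  define r where "r = sqrt (real (card E))"
  define n where "n = nat \<lfloor>r\<rfloor>"
  have r1: "1 \<le> r"
    using m by (simp add: r_def)
  have n: "1 \<le> n" "real n \<le> r" "r < real n + 1"
    unfolding n_def using r1 by linarith+
  have fin: "finite V"
    using graph by (simp add: simple_graph_def)
  obtain l where l: "1 \<le> l" "degree_bound TYPE('a) n l"
    "real l \<le> 2 ^ (13 * log_star (real n)) * real n"
    using degree_bound_log_star[OF n(1)] by blast
  define X where "X = {v\<in>V. \<not> card (nbhd V E v) \<le> n}"
  have "card (nbhd (V - X) E v) \<le> n" if "v \<in> V - X" for v
  proof -
    have "card (nbhd (V - X) E v) \<le> card (nbhd V E v)"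
      using fin by (intro card_mono) (auto simp: nbhd_def)
    then show ?thesis
      using that by (auto simp: X_def)
  qed
  then have "local_box (V - X) E l"
    using l(2) fin unfolding degree_bound_def by blast
  then have "local_box V E (l + card X)"
    using fin by (intro local_box_remove_vertices) (auto simp: X_def)
  then have "lbox V E \<le> l + card X"
    using graph l(1) by (intro lbox_le) auto
  moreover have "real (card X) \<le> 2 * r"
  proof -
    \<comment> \<open>Degrees in \<open>X\<close> are at least \<open>n + 1\<close>, which exceeds
      \<open>r\<close>, while all degrees sum to at most \<open>2 * r * r\<close>.\<close>
    have "of_nat (card X) * Suc n \<le> (\<Sum>v\<in>X. card (nbhd V E v))"
      by (rule sum_bounded_below) (auto simp: X_def)
    also have "\<dots> \<le> (\<Sum>v\<in>V. card (nbhd V E v))"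
      using fin by (intro sum_mono2) (auto simp: X_def)
    also have "\<dots> \<le> 2 * card E"
      by (rule sum_degrees_le[OF graph])
    finally have "card X * Suc n \<le> 2 * card E"
      by simp
    then have "real (card X * Suc n) \<le> real (2 * card E)"
      by (rule of_nat_mono)
    moreover have "real (card X) * r \<le> real (card X) * real (Suc n)"
      using n(3) by (intro mult_left_mono) auto
    moreover have "real (2 * card E) = 2 * r * r"
      by (simp add: r_def)
    ultimately have "real (card X) * r \<le> 2 * r * r"
      unfolding of_nat_mult by linarith
    then show ?thesis
      using r1 by simp
  qed
  moreover have "real l \<le> 2 ^ (13 * log_star r) * r"
  proof -
    have "(2::real) ^ (13 * log_star (real n)) \<le> 2 ^ (13 * log_star r)"
      using log_star_mono[OF n(2)] by (intro power_increasing) auto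
    then have "2 ^ (13 * log_star (real n)) * real n \<le> 2 ^ (13 * log_star r) * r"
      using n(2) by (intro mult_mono) auto
    then show ?thesis
      using l(3) by linarith
  qed
  ultimately have "real (lbox V E) \<le> 2 ^ (13 * log_star r) * r + 2 * r"
    by linarith
  then show ?thesis
    unfolding r_def by (simp add: distrib_right)
qed

section \<open>The lower bound\<close>

lemma card_subsets_card_le:
  assumes "finite X"
  shows "card {C. C \<subseteq> X \<and> card C \<le> r} \<le> (card X + 1) ^ r"
proof -
  \<comment> \<open>A set of at most \<open>r\<close> elements is listed by a word of length
    \<open>r\<close>, padded with the blank symbol \<open>None\<close>.\<close>
  let ?L = "{xs. set xs \<subseteq> insert None (Some ` X) \<and> length xs = r}"
  have fin: "finite (insert None (Some ` X))"
    using assms by simp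
  have "{C. C \<subseteq> X \<and> card C \<le> r} \<subseteq> (\<lambda>xs. {x. Some x \<in> set xs}) ` ?L"
  proof (rule subsetI, elim CollectE conjE)
    fix C assume C: "C \<subseteq> X" "card C \<le> r"
    then obtain ys where ys: "set ys = C" "distinct ys"
      using assms finite_distinct_list finite_subset by meson
    let ?xs = "map Some ys @ replicate (r - card C) None"
    have "length ys = card C"
      using ys distinct_card by fastforce
    then have "?xs \<in> ?L"
      using C ys by auto
    moreover have "C = {x. Some x \<in> set ?xs}"
      using ys by auto
    ultimately show "C \<in> (\<lambda>xs. {x. Some x \<in> set xs}) ` ?L"
      by blast
  qed
  then have "card {C. C \<subseteq> X \<and> card C \<le> r} \<le> card ?L"
    by (rule surj_card_le[OF finite_lists_length_eq[OF fin]])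
  also have "\<dots> = (card X + 1) ^ r"
    unfolding card_lists_length_eq[OF fin] using assms by (simp add: card_image)
  finally show ?thesis .
qed

text \<open>A graph is determined by the tuples \<open>(v, j, x, y)\<close> recording that \<open>v\<close> is non-universal in the
  interval graph \<open>j\<close>, in which its interval has left rank \<open>x\<close> and right rank \<open>y\<close>.\<close>
definition decode :: "nat \<Rightarrow> (nat \<times> nat \<times> nat \<times> nat) set \<Rightarrow> nat set set" where
  "decode n C = {{u, v} | u v. u < n \<and> v < n \<and> u \<noteq> v \<and>
     \<not> (\<exists>j x y x' y'. (u, j, x, y) \<in> C \<and> (v, j, x', y') \<in> C \<and> (y < x' \<or> y' < x))}"

text \<open>Counting the right endpoints below a value preserves strict comparisons of a right with
  a left endpoint: if \<open>b u < a v\<close>, then \<open>u\<close> itself is counted only on the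
  right-hand side.\<close>

lemma interval_ranks:
  fixes a b :: "nat \<Rightarrow> real"
  assumes "u < n" "v < n"
  shows "card {w\<in>{..<n}. b w < b u} < card {w\<in>{..<n}. b w < a v} \<longleftrightarrow> b u < a v"
proof
  assume "b u < a v"
  then have "{w\<in>{..<n}. b w < b u} \<subset> {w\<in>{..<n}. b w < a v}"
    using assms(1) by auto
  then show "card {w\<in>{..<n}. b w < b u} < card {w\<in>{..<n}. b w < a v}"
    by (intro psubset_card_mono) auto
next
  assume *: "card {w\<in>{..<n}. b w < b u} < card {w\<in>{..<n}. b w < a v}"
  show "b u < a v"
  proof (rule ccontr)
    assume "\<not> b u < a v"
    then have "card {w\<in>{..<n}. b w < a v} \<le> card {w\<in>{..<n}. b w < b u}"
      by (intro card_mono) auto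
    with * show False by simp
  qed
qed

text \<open>At most \<open>n * l\<close> indices have a non-universal vertex, so they can be
  renumbered below \<open>n * l\<close>. A non-adjacent pair is separated in some index where both
  vertices are non-universal, hence both are recorded in \<open>C\<close>.\<close>

lemma local_box_encode:
  assumes "simple_graph {..<n} E" and "local_box {..<n} E l"
  shows "\<exists>C. C \<subseteq> {..<n} \<times> {..<n * l} \<times> {..n} \<times> {..n} \<and> card C \<le> n * l \<and> E = decode n C"
proof -
  obtain J :: "nat set" and a b where fam: "box_family {..<n} E J a b l"
    using assms(2) unfolding local_box_def by blast
  define D where "D v = {j\<in>J. \<exists>u\<in>{..<n}. \<not> overlap (a j) (b j) u v}" for v
  have finD: "finite (D v)" for v
    using box_familyD(1)[OF fam] by (simp add: D_def)
  have cardD: "card (D v) \<le> l" if "v < n" for v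
    unfolding D_def using box_familyD(4)[OF fam, of v] that by simp
  define K where "K = (\<Union>v\<in>{..<n}. D v)"
  have finK: "finite K"
    using finD by (simp add: K_def)
  have "card K \<le> (\<Sum>v\<in>{..<n}. card (D v))"
    unfolding K_def by (rule card_UN_le) simp
  also have "\<dots> \<le> of_nat (card {..<n}) * l"
    using cardD by (intro sum_bounded_above) simp
  finally have "card K \<le> card {..<n * l}"
    by simp
  then obtain f where f: "f ` K \<subseteq> {..<n * l}" "inj_on f K"
    using card_le_inj[OF finK finite_lessThan] by blast
  define x where "x j v = card {w\<in>{..<n}. b j w < a j v}" for j v
  define y where "y j v = card {w\<in>{..<n}. b j w < b j v}" for j v
  have rank: "y j u < x j v \<longleftrightarrow> b j u < a j v" if "u < n" "v < n" for j u v
    unfolding x_def y_def using interval_ranks[OF that] .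
  have rank_le: "card {w\<in>{..<n}. P w} \<le> n" for P
    using card_mono[of "{..<n}" "{w\<in>{..<n}. P w}"] by fastforce
  define g where "g = (\<lambda>(v, j). (v, f j, x j v, y j v))"
  define C where "C = g ` (SIGMA v:{..<n}. D v)"
  have C_iff: "(v, i, p, q) \<in> C \<longleftrightarrow> v < n \<and> (\<exists>j\<in>D v. i = f j \<and> p = x j v \<and> q = y j v)" for v i p q
    by (auto simp: C_def g_def)
  have "C \<subseteq> {..<n} \<times> {..<n * l} \<times> {..n} \<times> {..n}"
  proof
    fix t assume "t \<in> C"
    then obtain v j where "v < n" "j \<in> D v" "t = (v, f j, x j v, y j v)"
      by (auto simp: C_def g_def)
    moreover from this have "f j \<in> {..<n * l}"
      using f(1) by (auto simp: K_def)
    ultimately show "t \<in> {..<n} \<times> {..<n * l} \<times> {..n} \<times> {..n}"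
      using rank_le by (simp add: x_def y_def)
  qed
  moreover have "card C \<le> n * l"
  proof -
    have "card C \<le> card (SIGMA v:{..<n}. D v)"
      unfolding C_def using finD by (intro card_image_le) auto
    also have "\<dots> = (\<Sum>v\<in>{..<n}. card (D v))"
      using finD by (intro card_SigmaI) auto
    also have "\<dots> \<le> of_nat (card {..<n}) * l"
      using cardD by (intro sum_bounded_above) simp
    finally show ?thesis by simp
  qed
  moreover have "E = decode n C"
  proof -
    let ?sep = "\<lambda>u v. \<exists>i p q p' q'. (u, i, p, q) \<in> C \<and> (v, i, p', q') \<in> C \<and> (q < p' \<or> q' < p)"
    have sep: "{u, v} \<in> E \<longleftrightarrow> \<not> ?sep u v" if uv: "u < n" "v < n" "u \<noteq> v" for u v
    proof -
      have "?sep u v \<longleftrightarrow> (\<exists>j\<in>J. \<not> overlap (a j) (b j) u v)"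
      proof
        assume "?sep u v"
        then obtain j j' where j: "j \<in> D u" "j' \<in> D v" "f j = f j'"
          and lt: "y j u < x j' v \<or> y j' v < x j u"
          unfolding C_iff by blast
        have "j \<in> K" "j' \<in> K"
          using j(1,2) uv(1,2) unfolding K_def by blast+
        then have "j = j'"
          using inj_onD[OF f(2) j(3)] by simp
        then have "\<not> overlap (a j) (b j) u v"
          using lt rank[OF uv(1,2), of j] rank[OF uv(2,1), of j] by (auto simp: overlap_def)
        moreover have "j \<in> J"
          using j(1) by (simp add: D_def)
        ultimately show "\<exists>j\<in>J. \<not> overlap (a j) (b j) u v"
          by blast
      next
        assume "\<exists>j\<in>J. \<not> overlap (a j) (b j) u v"
        then obtain j where j: "j \<in> J" "\<not> overlap (a j) (b j) u v"
          by blast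
        then have "j \<in> D u" "j \<in> D v"
          using uv overlap_commute unfolding D_def by fastforce+
        then have "(u, f j, x j u, y j u) \<in> C" "(v, f j, x j v, y j v) \<in> C"
          using uv unfolding C_iff by blast+
        moreover have "y j u < x j v \<or> y j v < x j u"
          using j(2) rank[OF uv(1,2), of j] rank[OF uv(2,1), of j] by (auto simp: overlap_def)
        ultimately show "?sep u v" by blast
      qed
      then show ?thesis
        using box_familyD(3)[OF fam, of u v] uv by simp
    qed
    show ?thesis
    proof (intro set_eqI iffI)
      fix e assume "e \<in> E"
      then have "e \<subseteq> {..<n}" "card e = 2"
        using assms(1) by (auto simp: simple_graph_def)
      then obtain u v where uv: "e = {u, v}" "u < n" "v < n" "u \<noteq> v"
        by (auto simp: card_2_iff)
      then show "e \<in> decode n C"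
        using sep[OF uv(2-4)] \<open>e \<in> E\<close> unfolding decode_def by blast
    next
      fix e assume "e \<in> decode n C"
      then obtain u v where uv: "e = {u, v}" "u < n" "v < n" "u \<noteq> v" "\<not> ?sep u v"
        unfolding decode_def by blast
      then show "e \<in> E"
        using sep[OF uv(2-4)] by simp
    qed
  qed
  ultimately show ?thesis by blast
qed

text \<open>For \<open>l \<le> n\<close> there are fewer than \<open>(n + 1) ^ 5\<close> tuples, and
  at most \<open>n * l\<close> of them describe a graph.\<close>

lemma card_local_box_le:
  assumes "l \<le> n"
  shows "card {E. simple_graph {..<n} E \<and> local_box {..<n} E l} \<le> (n + 1) ^ (5 * n * l)"
proof -
  let ?X = "{..<n} \<times> {..<n * l} \<times> {..n} \<times> {..n}"
  let ?C = "{C. C \<subseteq> ?X \<and> card C \<le> n * l}"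
  have "{E. simple_graph {..<n} E \<and> local_box {..<n} E l} \<subseteq> decode n ` ?C"
    using local_box_encode by blast
  moreover have "finite ?C"
    by (rule finite_subset[of _ "Pow ?X"]) auto
  ultimately have "card {E. simple_graph {..<n} E \<and> local_box {..<n} E l} \<le> card ?C"
    by (rule surj_card_le[rotated])
  also have "\<dots> \<le> (card ?X + 1) ^ (n * l)"
    by (rule card_subsets_card_le) simp
  also have "card ?X + 1 \<le> (n + 1) ^ 5"
  proof -
    have "card ?X = n * (n * l) * (n + 1) ^ 2"
      by (simp add: card_cartesian_product power2_eq_square algebra_simps)
    also have "\<dots> \<le> n * (n * n) * (n + 1) ^ 2"
      using assms by simp
    finally have "card ?X + 1 \<le> n * (n * n) * (n + 1) ^ 2 + (n + 1) ^ 2"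
      by (rule add_mono) simp
    also have "\<dots> = (n * (n * n) + 1) * (n + 1) ^ 2"
      by (simp add: algebra_simps)
    also have "\<dots> \<le> (n + 1) ^ 3 * (n + 1) ^ 2"
      by (intro mult_le_mono1) (simp add: power3_eq_cube algebra_simps)
    finally show ?thesis
      by (simp flip: power_add)
  qed
  then have "(card ?X + 1) ^ (n * l) \<le> ((n + 1) ^ 5) ^ (n * l)"
    by (rule power_mono) simp
  finally show ?thesis
    by (simp add: power_mult[symmetric] mult.assoc)
qed

section \<open>Graphs of large local boxicity with a prescribed number of edges\<close>

lemma simple_graph_lessThan: "simple_graph {..<n :: nat} E \<longleftrightarrow> E \<subseteq> {e. e \<subseteq> {..<n} \<and> card e = 2}"
  by (auto simp: simple_graph_def)

lemma card_edges_lessThan: "card {e. e \<subseteq> {..<n :: nat} \<and> card e = 2} = n choose 2"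
  by (simp add: n_subsets)

lemma finite_edges_lessThan: "finite {e. e \<subseteq> {..<n :: nat} \<and> card e = 2}"
  by (rule finite_subset[of _ "Pow {..<n}"]) auto

lemma ex_graph_large_local_box:
  assumes "2 \<le> n"
  shows "\<exists>E. simple_graph {..<n} E \<and> (\<forall>l. local_box {..<n} E l \<longrightarrow> real n - 1 \<le> 10 * real l * log 2 (real n + 1))"
proof -
  \<comment> \<open>The value of \<open>l\<close> for which \<open>(n + 1) ^ (5 * n * l)\<close>
    would equal \<open>2 ^ (n choose 2)\<close>.\<close>
  define x where "x = (real n - 1) / (10 * log 2 (real n + 1))"
  \<comment> \<open>The largest natural number strictly below \<open>x\<close>: the count falls
    short at \<open>l\<close>, and every larger number is at least \<open>x\<close>.\<close>
  define l where "l = nat (\<lceil>x\<rceil> - 1)"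
  have "log 2 2 \<le> log 2 (real n + 1)"
    using assms by (subst log_le_cancel_iff) auto
  then have log: "1 \<le> log 2 (real n + 1)"
    by simp
  then have "0 < x" "x \<le> real n"
    using assms by (auto simp: x_def divide_simps mult_nonneg_nonneg) (use log mult_left_mono[of 1 "log 2 (real n + 1)" "real n"] in linarith)
  then have l: "real l < x" "x \<le> real (Suc l)"
    unfolding l_def by linarith+
  have "l \<le> n"
    using l \<open>x \<le> real n\<close> by linarith
  have "10 * real l * log 2 (real n + 1) < real n - 1"
    using l(1) log by (simp add: x_def field_simps)
  then have "real n * (10 * real l * log 2 (real n + 1)) < real n * (real n - 1)"
    using assms by (intro mult_strict_left_mono) auto
  then have "real (5 * n * l) * log 2 (real n + 1) < real n * (real n - 1) / 2"
    by simp
  also have "\<dots> = real (n choose 2)"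
  proof -
    have "even (n * (n - 1))"
      by auto
    then have "2 * (n choose 2) = n * (n - 1)"
      unfolding choose_two by (rule dvd_mult_div_cancel)
    then have "2 * real (n choose 2) = real n * real (n - 1)"
      by (metis of_nat_mult of_nat_numeral)
    then show ?thesis
      using assms by (simp add: of_nat_diff)
  qed
  finally have "2 powr (log 2 (real n + 1) * real (5 * n * l)) < 2 powr real (n choose 2)"
    by (intro powr_less_mono) (simp_all add: mult.commute)
  then have "real ((n + 1) ^ (5 * n * l)) < real (2 ^ (n choose 2))"
    using assms by (simp add: powr_powr[symmetric] powr_realpow add.commute del: of_nat_mult)
  then have less: "(n + 1) ^ (5 * n * l) < 2 ^ (n choose 2)"
    by linarith
  have "\<exists>E. simple_graph {..<n} E \<and> \<not> local_box {..<n} E l"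
  proof (rule ccontr)
    assume "\<not> ?thesis"
    then have "{E. simple_graph {..<n} E \<and> local_box {..<n} E l} = Pow {e. e \<subseteq> {..<n} \<and> card e = 2}"
      unfolding simple_graph_lessThan by blast
    then have "card {E. simple_graph {..<n} E \<and> local_box {..<n} E l} = 2 ^ (n choose 2)"
      by (simp add: card_Pow[OF finite_edges_lessThan] card_edges_lessThan)
    then show False
      using card_local_box_le[OF \<open>l \<le> n\<close>] less by simp
  qed
  then obtain E where E: "simple_graph {..<n} E" "\<not> local_box {..<n} E l"
    by blast
  have "real n - 1 \<le> 10 * real l' * log 2 (real n + 1)" if "local_box {..<n} E l'" for l'
  proof -
    have "Suc l \<le> l'"
      using E(2) that local_box_mono by (metis not_less_eq_eq)
    then have "x \<le> real l'"
      using l(2) by linarith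
    then show ?thesis
      using log by (simp add: x_def field_simps)
  qed
  with E(1) show ?thesis by blast
qed

lemma ex_graph_with_edge_count:
  fixes m :: nat
  shows "\<exists>(V :: nat set) E. simple_graph V E \<and> card E = m \<and>
    (16 \<le> m \<longrightarrow> sqrt (real m) / log 2 (real m) \<le> 20 * real (lbox V E))"
proof -
  define n where "n = nat \<lfloor>sqrt (real m)\<rfloor>"
  have n: "real n \<le> sqrt (real m)" "sqrt (real m) < real n + 1"
    unfolding n_def using real_sqrt_ge_zero[of "real m"] by linarith+
  obtain E where E: "simple_graph {..<n} E"
    and big: "2 \<le> n \<Longrightarrow> local_box {..<n} E l \<Longrightarrow> real n - 1 \<le> 10 * real l * log 2 (real n + 1)" for l
  proof (cases "2 \<le> n")
    case True
    then show ?thesis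
      using ex_graph_large_local_box[OF True] that by blast
  next
    case False
    show ?thesis
      by (rule that[of "{}"]) (use False in \<open>simp_all add: simple_graph_def\<close>)
  qed
  have E_sub: "E \<subseteq> {e. e \<subseteq> {..<n} \<and> card e = 2}"
    using E simple_graph_lessThan by blast
  have "card E \<le> m"
  proof -
    have "card E \<le> n choose 2"
      using card_mono[OF finite_edges_lessThan E_sub] by (simp add: card_edges_lessThan)
    also have "\<dots> \<le> n * n"
      by (simp add: choose_two) (metis diff_le_self div_le_dividend le_trans mult_le_mono2)
    also have "\<dots> \<le> m"
    proof -
      have "real n * real n \<le> sqrt (real m) * sqrt (real m)"
        using n(1) by (intro mult_mono) auto
      then have "real (n * n) \<le> real m"
        by simp
      then show ?thesis by linarith
    qed
    finally show ?thesis .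
  qed
  \<comment> \<open>A star centred at the new vertex \<open>n\<close> supplies the missing edges and
    leaves the induced graph on the first \<open>n\<close> vertices unchanged.\<close>
  define S where "S = (\<lambda>j. {n, j}) ` {n<..n + (m - card E)}"
  define V where "V = {..n + (m - card E)}"
  have graph: "simple_graph V (E \<union> S)"
    using E unfolding simple_graph_def V_def S_def by (auto simp: subset_iff) fastforce+
  have disj: "E \<inter> S = {}"
    using E_sub by (auto simp: S_def)
  have "card S = m - card E"
    unfolding S_def by (subst card_image) (auto simp: inj_on_def doubleton_eq_iff)
  moreover have "finite E"
    using E_sub finite_edges_lessThan finite_subset by blast
  ultimately have card: "card (E \<union> S) = m"
    using disj \<open>card E \<le> m\<close> by (subst card_Un_disjoint) (auto simp: S_def)
  have "sqrt (real m) / log 2 (real m) \<le> 20 * real (lbox V (E \<union> S))" if m: "16 \<le> m"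
  proof -
    have "sqrt 16 \<le> sqrt (real m)"
      using m by (intro real_sqrt_le_mono) simp
    then have s4: "4 \<le> sqrt (real m)"
      by simp
    then have n2: "2 \<le> n"
      using n by linarith
    \<comment> \<open>Any finite bound will do here; it guarantees that \<open>lbox\<close> is
      attained.\<close>
    obtain l0 where "local_box V (E \<union> S) l0"
      using local_box_degree_square[of V "E \<union> S" "Max ((\<lambda>v. card (nbhd V (E \<union> S) v)) ` V)"]
      by (auto simp: V_def)
    from local_box_lbox[OF graph this]
    have "local_box {..<n} E (lbox V (E \<union> S))"
      by (rule local_box_induced) (auto simp: V_def S_def doubleton_eq_iff)
    then have *: "real n - 1 \<le> 10 * real (lbox V (E \<union> S)) * log 2 (real n + 1)"
      using big[OF n2] by blast
    have "real n + 1 \<le> real m"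
    proof -
      have "4 * sqrt (real m) \<le> sqrt (real m) * sqrt (real m)"
        using s4 by (intro mult_right_mono) auto
      then show ?thesis
        using n(1) s4 by simp
    qed
    then have "log 2 (real n + 1) \<le> log 2 (real m)"
      using m by (subst log_le_cancel_iff) auto
    then have "10 * real (lbox V (E \<union> S)) * log 2 (real n + 1) \<le> 10 * real (lbox V (E \<union> S)) * log 2 (real m)"
      by (intro mult_left_mono) auto
    \<comment> \<open>Follows from \<open>n > sqrt m - 1\<close> and \<open>sqrt m \<ge> 4\<close>;
      passing from \<open>n - 1\<close> to \<open>sqrt m\<close> doubles the constant 10.\<close>
    moreover have "sqrt (real m) \<le> 2 * real n - 2"
      using n(2) s4 by linarith
    ultimately have "sqrt (real m) \<le> 20 * real (lbox V (E \<union> S)) * log 2 (real m)"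
      using * by linarith
    moreover have "0 < log 2 (real m)"
      using m by simp
    ultimately show ?thesis
      by (simp add: divide_le_eq)
  qed
  with graph card show ?thesis by blast
qed

theorem corollary9:
  shows "(\<forall>(V :: 'a set) (E :: 'a set set) (m :: nat).
            simple_graph V E \<and> card E = m \<and> 1 \<le> m \<longrightarrow>
              real (lbox V E) \<le> (2 ^ (13 * log_star (sqrt (real m))) + 2) * sqrt (real m)) \<and>
         (\<exists>(W :: nat \<Rightarrow> nat set) (F :: nat \<Rightarrow> nat set set).
            (\<forall>m. simple_graph (W m) (F m) \<and> card (F m) = m) \<and>
            (\<lambda>m. real (lbox (W m) (F m))) \<in> \<Omega>(\<lambda>m. sqrt (real m) / log 2 (real m)))"
proof
  show "\<forall>(V :: 'a set) (E :: 'a set set) (m :: nat).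
            simple_graph V E \<and> card E = m \<and> 1 \<le> m \<longrightarrow>
              real (lbox V E) \<le> (2 ^ (13 * log_star (sqrt (real m))) + 2) * sqrt (real m)"
    using lbox_upper_bound by blast
  obtain W :: "nat \<Rightarrow> nat set" and F where WF: "\<And>m. simple_graph (W m) (F m)" "\<And>m. card (F m) = m"
    and lower: "\<And>m. 16 \<le> m \<Longrightarrow> sqrt (real m) / log 2 (real m) \<le> 20 * real (lbox (W m) (F m))"
    using ex_graph_with_edge_count by metis
  have "eventually (\<lambda>m. 1 / 20 * norm (sqrt (real m) / log 2 (real m)) \<le> norm (real (lbox (W m) (F m)))) at_top"
    using eventually_ge_at_top[of "16 :: nat"]
  proof eventually_elim
    case (elim m)
    then show ?case
      using lower[OF elim] by simp
  qed
  then have "(\<lambda>m. real (lbox (W m) (F m))) \<in> \<Omega>(\<lambda>m. sqrt (real m) / log 2 (real m))"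
    by (intro landau_omega.bigI[of "1 / 20"]) auto
  with WF show "\<exists>(W :: nat \<Rightarrow> nat set) (F :: nat \<Rightarrow> nat set set).
            (\<forall>m. simple_graph (W m) (F m) \<and> card (F m) = m) \<and>
            (\<lambda>m. real (lbox (W m) (F m))) \<in> \<Omega>(\<lambda>m. sqrt (real m) / log 2 (real m))"
    by blast
qed

end
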